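(* Let $m$ be an integer such that $q=4m^2+4m+3$ is a prime power. Let $\omega$ be a primitive element of $\mathbb{F}_{q^2}$, $C_i^{(8,q^2)}=\omega^i\langle\omega^8\rangle$ (indices mod 8), $\chi_8$ the multiplicative character of $\mathbb{F}_{q^2}$ with $\chi_8(\omega)=\zeta_8=e^{2\pi i/8}$, $\zeta_4=i$, and $\eta$ the quadratic character of $\mathbb{F}_q$. Let $\epsilon,\delta\in\{1,-1\}$ be such that $G_{q^2}(\chi_8)=G_q(\eta)(\epsilon(2m+1)+\delta\sqrt{-2})$ (such signs exist). Let $h'\in\{0,1,2,3\}$, put $h=2h'+(1-\epsilon\delta)/2$, and let $\ell$ be an integer not divisible by $q+1$ such that \[ \chi_8(\omega^\ell)=\zeta_8^{2-5\epsilon\delta-6h'},\qquad \chi_8(\omega^{\ell q}-\omega^\ell)=-\zeta_4^{\delta}. \] Let $H=\{h+i \bmod 8: i=0,1,2,3\}$ and $D_{\ell,H}=\{x\in\mathbb{F}_q: 1+x\omega^\ell\in\bigcup_{i\in H}C_i^{(8,q^2)}\}$. Then $|D_{\ell,H}|=2m^2+m+2$ and \[ \{|D_{\ell,H}\cap((C_0^{(2,q)}\cup\{0\})+s)|: s\in\mathbb{F}_q\}=\{m^2+1,m^2+2,m^2+m+1,m^2+m+2\}, \] where $C_0^{(2,q)}$ is the set of nonzero squares of $\mathbb{F}_q$.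
   Context: For a prime power $Q=p^f$, the canonical additive character of $\mathbb{F}_Q$ is $\psi_{\mathbb{F}_Q}(x)=\exp(2\pi i\,\mathrm{Tr}_{Q/p}(x)/p)$, and for a multiplicative character $\chi$ of $\mathbb{F}_Q$ the Gauss sum is $G_Q(\chi)=\sum_{x\in\mathbb{F}_Q^*}\chi(x)\psi_{\mathbb{F}_Q}(x)$.
   Formalization: The set of intersection sizes is claimed only for m ≠ −1: for m = −1 (q = 3) one has D = F_3, so every intersection has size 2 and the stated equality fails. The size of D is proved for all m. The existence of the signs ε, δ is not proved; they are given with the Gauss sum equation. *)

theory Defs
  imports "HOL-Analysis.Analysis" "HOL-Number_Theory.Number_Theory"
begin

text \<open>
  The field with \<open>q\<^sup>2\<close> elements is a type of class \<open>{field, finite}\<close>; its subfield with \<open>q\<close>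
  elements is a subset of that type. Traces, additive characters and Gauss sums are
  parameterised by a subfield \<open>K\<close>, so that \<open>K = UNIV\<close> gives the notions for the whole field.
\<close>

definition is_subfield :: "'a::field set \<Rightarrow> bool" where
  "is_subfield K \<longleftrightarrow> 0 \<in> K \<and> 1 \<in> K \<and>
     (\<forall>x\<in>K. \<forall>y\<in>K. x + y \<in> K \<and> x * y \<in> K) \<and> (\<forall>x\<in>K. - x \<in> K \<and> inverse x \<in> K)"

definition primitive_element :: "'a::field \<Rightarrow> bool" where
  "primitive_element w \<longleftrightarrow> range (\<lambda>k::nat. w ^ k) = UNIV - {0}"

definition prime_degree :: "'a::field set \<Rightarrow> nat" where
  "prime_degree K = (THE f. card K = CHAR('a) ^ f)"

definition abs_trace :: "'a::field set \<Rightarrow> 'a \<Rightarrow> 'a" where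
  "abs_trace K x = (\<Sum>i<prime_degree K. x ^ (CHAR('a) ^ i))"

text \<open>The trace lies in the prime field, whose elements are lifted to \<open>{0..<p}\<close>.\<close>

definition prime_field_lift :: "'a::field \<Rightarrow> nat" where
  "prime_field_lift y = (THE n. n < CHAR('a) \<and> of_nat n = y)"

definition canonical_add_char :: "'a::field set \<Rightarrow> 'a \<Rightarrow> complex" where
  "canonical_add_char K x =
     exp (2 * of_real pi * \<i> * of_nat (prime_field_lift (abs_trace K x)) / of_nat CHAR('a))"

text \<open>The value of a multiplicative character at \<open>0\<close> is left unconstrained; it is never used.\<close>

definition mult_char :: "'a::field set \<Rightarrow> ('a \<Rightarrow> complex) \<Rightarrow> bool" where
  "mult_char K chi \<longleftrightarrow> (\<forall>x\<in>K - {0}. chi x \<noteq> 0) \<and>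
     (\<forall>x\<in>K - {0}. \<forall>y\<in>K - {0}. chi (x * y) = chi x * chi y)"

definition gauss_sum :: "'a::field set \<Rightarrow> ('a \<Rightarrow> complex) \<Rightarrow> complex" where
  "gauss_sum K chi = (\<Sum>x\<in>K - {0}. chi x * canonical_add_char K x)"

definition nonzero_squares :: "'a::field set \<Rightarrow> 'a set" where
  "nonzero_squares K = {y\<^sup>2 | y. y \<in> K \<and> y \<noteq> 0}"

definition quad_char :: "'a::field set \<Rightarrow> 'a \<Rightarrow> complex" where
  "quad_char K x = (if x = 0 then 0 else if x \<in> nonzero_squares K then 1 else - 1)"

definition cyc_class :: "nat \<Rightarrow> 'a::field \<Rightarrow> int \<Rightarrow> 'a set" where
  "cyc_class N w i = {w powi i * (w ^ N) powi k | k :: int. True}"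

definition D_set :: "'a::field set \<Rightarrow> 'a \<Rightarrow> int \<Rightarrow> int set \<Rightarrow> 'a set" where
  "D_set K w l H = {x \<in> K. 1 + x * w powi l \<in> (\<Union>i\<in>H. cyc_class 8 w i)}"

end

theory Submission
  imports Defs
begin

text \<open>
  Write \<open>A = \<omega>\<^sup>l\<close>. Since \<open>q \<equiv> 3 (mod 8)\<close>, the character \<open>\<chi>\<^sub>8\<close> restricts to \<open>\<eta>\<close> on the subfield, so grouping
  \<open>G(\<chi>\<^sub>8)\<close> by relative trace gives \<open>G(\<chi>\<^sub>8) = E * G(\<eta>)\<close>, where \<open>E\<close> is the sum of \<open>\<chi>\<^sub>8\<close> over the elements
  of relative trace \<open>1\<close>. As \<open>G(\<eta>) \<noteq> 0\<close>, the hypothesis says \<open>E = \<epsilon>(2m+1) + \<delta>\<surd>-2\<close>. Every affine line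
  avoiding \<open>0\<close> is a multiple of the trace-one line, which evaluates the sum of \<open>\<chi>\<^sub>8(1+xA)\<close> over \<open>x\<close>, and
  the substitution \<open>y = 1/(x-s)\<close> does the same for the sum of \<open>\<eta>(x-s) \<chi>\<^sub>8(1+xA)\<close>; the latter depends
  only on the class of \<open>1+sA\<close> modulo \<open>8\<close>. Comparing coefficients of \<open>1, \<zeta>, \<zeta>\<^sup>2, \<zeta>\<^sup>3\<close> with \<open>\<zeta> = \<zeta>\<^sub>8\<close> yields
  the size of \<open>D\<close> and the intersection numbers as functions of that class. All four values occur because the
  points \<open>1+xA\<close> and \<open>A\<close> represent the projective line, hence are equidistributed modulo \<open>4\<close>,
  which together with the first sum gives the number of \<open>s\<close> in each class modulo \<open>8\<close>.
\<close>

section \<open>Finite fields and their quadratic extensions\<close>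

lemma prime_CHAR_finite_field: "prime CHAR('a::{field,finite})"
  using prime_CHAR_semidom[where ?'a = 'a] finite_imp_CHAR_pos[where ?'a = 'a] by simp

lemma is_subfield_UNIV: "is_subfield (UNIV :: 'a::field set)"
  by (simp add: is_subfield_def)

lemma subfield_mult_nonzero_bij:
  fixes K :: "'a::field set"
  assumes "is_subfield K" "c \<in> K - {0}"
  shows "bij_betw ((*) c) (K - {0}) (K - {0})"
proof (rule bij_betw_byWitness[where f' = "(*) (inverse c)"])
qed (use assms in \<open>auto simp: is_subfield_def\<close>)

text \<open>Multiplying every factor by \<open>x\<close> permutes the nonzero elements of
  \<open>K\<close>, so their product is unchanged and the extracted power of \<open>x\<close> is
  1.\<close>

lemma subfield_power_card_minus_1:
  fixes K :: "'a::{field,finite} set"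
  assumes K: "is_subfield K" and x: "x \<in> K - {0}"
  shows "x ^ (card K - 1) = 1"
proof -
  have "(\<Prod>y\<in>K - {0}. y) = (\<Prod>y\<in>K - {0}. x * y)"
    using prod.reindex_bij_betw[OF subfield_mult_nonzero_bij[OF K x], of "\<lambda>y. y"] by simp
  also have "\<dots> = x ^ (card K - 1) * (\<Prod>y\<in>K - {0}. y)"
    using K by (simp add: prod.distrib is_subfield_def card_Diff_singleton)
  finally show ?thesis by simp
qed

lemma card_power_fixed_le:
  assumes "n \<ge> 2"
  shows "card {x::'a::{field,finite}. x ^ n = x} \<le> n"
proof -
  define P where "P = Polynomial.monom (1::'a) n - Polynomial.monom 1 1"
  have d: "degree P = n"
    using degree_add_eq_left[of "- Polynomial.monom 1 1" "Polynomial.monom (1::'a) n"] assms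
    by (simp add: P_def degree_monom_eq)
  have "P \<noteq> 0" using d assms by auto
  from card_poly_roots_bound[OF this] show ?thesis
    unfolding d by (simp add: P_def poly_monom)
qed

lemma prime_field_image:
  "of_nat ` {..<CHAR('a)} = {x::'a::{field,finite}. x ^ CHAR('a) = x}"
proof (rule card_seteq)
  have "(of_nat n :: 'a) ^ CHAR('a) = of_nat n" for n
    by (induction n)
      (simp_all add: freshmans_dream[OF prime_CHAR_finite_field] prime_CHAR_finite_field prime_gt_0_nat)
  then show "of_nat ` {..<CHAR('a)} \<subseteq> {x::'a. x ^ CHAR('a) = x}"
    by auto
  have "card (of_nat ` {..<CHAR('a)} :: 'a set) = CHAR('a)"
    by (subst card_image) (auto intro!: inj_onI simp: of_nat_eq_iff_cong_CHAR cong_def)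
  then show "card {x::'a. x ^ CHAR('a) = x} \<le> card (of_nat ` {..<CHAR('a)} :: 'a set)"
    using card_power_fixed_le[OF prime_ge_2_nat[OF prime_CHAR_finite_field]] by simp
qed auto

text \<open>Makes the definite description in \<open>prime_field_lift\<close> meaningful on the
  fixed points of Frobenius, where every trace value lies.\<close>

lemma prime_field_lift:
  fixes y :: "'a::{field,finite}"
  assumes "y ^ CHAR('a) = y"
  shows "prime_field_lift y < CHAR('a)" "of_nat (prime_field_lift y) = y"
proof -
  have "y \<in> of_nat ` {..<CHAR('a)}"
    unfolding prime_field_image using assms by simp
  then obtain n where n: "n < CHAR('a)" "of_nat n = y"
    by blast
  have "prime_field_lift y < CHAR('a) \<and> of_nat (prime_field_lift y) = y"
    unfolding prime_field_lift_def
  proof (rule theI[of _ n])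
    show "k = n" if "k < CHAR('a) \<and> of_nat k = y" for k
      using that n of_nat_eq_iff_cong_CHAR[where ?'a = 'a, of k n] by (simp add: cong_def)
  qed (use n in simp)
  then show "prime_field_lift y < CHAR('a)" "of_nat (prime_field_lift y) = y"
    by blast+
qed

lemma prime_degree_eqI:
  fixes K :: "'a::{field,finite} set"
  assumes "card K = CHAR('a) ^ f"
  shows "prime_degree K = f"
  unfolding prime_degree_def
  using assms prime_gt_1_nat[OF prime_CHAR_finite_field[where ?'a = 'a]]
  by (intro the_equality) auto

section \<open>Frobenius map and discrete logarithms in the quadratic extension\<close>

locale quadratic_extension =
  fixes K :: "'a::{field,finite} set" and q :: nat and \<omega> :: 'a
  assumes primepow_q: "primepow q"
    and card_field: "CARD('a) = q\<^sup>2"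
    and subfield: "is_subfield K"
    and card_K: "card K = q"
    and primitive: "primitive_element \<omega>"
begin

lemma q_gt_1: "q > 1"
  using primepow_gt_Suc_0[OF primepow_q] by simp

lemma q_CHAR_power: obtains f where "f > 0" "q = CHAR('a) ^ f"
proof -
  obtain r k where rk: "prime r" "k > 0" "q = r ^ k"
    using primepow_q by (auto simp: primepow_def)
  have "CHAR('a) dvd r ^ (k * 2)"
    using CHAR_dvd_CARD[where ?'a = 'a] by (simp add: card_field rk(3) power_mult)
  then have "CHAR('a) = r"
    using prime_CHAR_finite_field[where ?'a = 'a] rk(1) prime_dvd_power primes_dvd_imp_eq by blast
  with rk that show ?thesis by auto
qed

lemma frobenius_add: "((x::'a) + y) ^ q = x ^ q + y ^ q"
  using q_CHAR_power freshmans_dream'[OF prime_CHAR_finite_field] by metis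

lemma frobenius_uminus: "(- x::'a) ^ q = - (x ^ q)"
  using frobenius_add[of x "- x"] q_gt_1 by (simp add: eq_neg_iff_add_eq_0 add.commute power_0_left)

lemma frobenius_diff: "((x::'a) - y) ^ q = x ^ q - y ^ q"
  using frobenius_add[of x "- y"] by (simp add: frobenius_uminus)

lemma frobenius_frobenius: "((x::'a) ^ q) ^ q = x"
proof (cases "x = 0")
  case False
  have "x ^ (q\<^sup>2 - 1) = 1"
    using subfield_power_card_minus_1[OF is_subfield_UNIV, of x] False by (simp add: card_field)
  then have "x ^ (q\<^sup>2 - 1) * x = x" by simp
  then have "x ^ (q\<^sup>2) = x"
    using q_gt_1 by (simp flip: power_Suc2)
  then show ?thesis by (simp add: power2_eq_square power_mult)
qed (use q_gt_1 in simp)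

text \<open>Elements of \<open>K\<close> are roots of \<open>X^q - X\<close>, which has at most
  \<open>q = card K\<close> roots. Membership in \<open>K\<close> thus becomes an equation that the
  Frobenius rules can rewrite.\<close>

lemma mem_K_iff: "x \<in> K \<longleftrightarrow> x ^ q = x"
proof -
  have "K = {x. x ^ q = x}"
  proof (rule card_seteq)
    have "x ^ q = x" if "x \<in> K" "x \<noteq> 0" for x
    proof -
      have "x ^ (q - 1) * x = x"
        using subfield_power_card_minus_1[OF subfield, of x] that by (simp add: card_K)
      then show ?thesis using q_gt_1 by (simp flip: power_Suc2)
    qed
    moreover have "(0::'a) ^ q = 0" using q_gt_1 by simp
    ultimately show "K \<subseteq> {x. x ^ q = x}" by blast
    show "card {x::'a. x ^ q = x} \<le> card K"
      using card_power_fixed_le[of q] q_gt_1 by (simp add: card_K)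
  qed auto
  then show ?thesis by auto
qed

lemma zero_in_K: "0 \<in> K" and one_in_K: "1 \<in> K"
  using subfield by (auto simp: is_subfield_def)

lemma K_closed:
  assumes "x \<in> K" "y \<in> K"
  shows "x + y \<in> K" "x - y \<in> K" "x * y \<in> K" "x / y \<in> K"
  using assms
  by (simp_all add: mem_K_iff frobenius_add frobenius_diff power_mult_distrib power_divide)

lemma K_uminus: "x \<in> K \<Longrightarrow> - x \<in> K"
  by (simp add: mem_K_iff frobenius_uminus)

lemma omega_nonzero: "\<omega> \<noteq> 0"
proof
  assume "\<omega> = 0"
  then have "\<omega> ^ 1 = 0" by simp
  then have "0 \<in> range (\<lambda>k::nat. \<omega> ^ k)" by (metis rangeI)
  then show False using primitive by (simp add: primitive_element_def)
qed

lemma omega_power_order: "\<omega> ^ (q\<^sup>2 - 1) = 1"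
  using subfield_power_card_minus_1[OF is_subfield_UNIV, of \<omega>] omega_nonzero
  by (simp add: card_field)

text \<open>Exponents below \<open>d = q^2 - 1\<close> already produce all \<open>d\<close> nonzero
  elements, so these powers are distinct and the order of \<open>\<omega>\<close> is exactly
  \<open>d\<close>.\<close>

lemma omega_powi_eq_1_iff: "\<omega> powi n = 1 \<longleftrightarrow> (int q)\<^sup>2 - 1 dvd n"
proof -
  define d where "d = q\<^sup>2 - 1"
  have "q\<^sup>2 \<ge> 2\<^sup>2" using q_gt_1 by (intro power_mono) auto
  then have d: "int d = (int q)\<^sup>2 - 1" "d > 0" by (auto simp: d_def of_nat_diff)
  have order: "\<omega> ^ d = 1" using omega_power_order by (simp add: d_def)
  have red: "\<omega> ^ k = \<omega> ^ (k mod d)" for k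
  proof -
    have "\<omega> ^ k = \<omega> ^ (d * (k div d) + k mod d)" by simp
    then show ?thesis by (simp only: power_add power_mult order power_one mult_1)
  qed
  have "range (\<lambda>k. \<omega> ^ k) = (\<lambda>k. \<omega> ^ k) ` {..<d}"
  proof (intro equalityI subsetI)
    fix x assume "x \<in> range (\<lambda>k. \<omega> ^ k)"
    then obtain k where "x = \<omega> ^ (k mod d)" using red by blast
    then show "x \<in> (\<lambda>k. \<omega> ^ k) ` {..<d}" using d(2) by simp
  qed auto
  then have "UNIV - {0} = (\<lambda>k. \<omega> ^ k) ` {..<d}"
    using primitive by (simp add: primitive_element_def)
  then have "card ((\<lambda>k. \<omega> ^ k) ` {..<d}) = d"
    using card_field by (metis card_Diff_singleton UNIV_I d_def)
  then have inj: "inj_on (\<lambda>k. \<omega> ^ k) {..<d}"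
    by (simp add: eq_card_imp_inj_on)
  define r where "r = nat (n mod int d)"
  have r: "r < d" "int r = n mod int d" using d(2) by (auto simp: r_def nat_less_iff)
  have "\<omega> powi n = \<omega> powi (int d * (n div int d) + int r)" unfolding r(2) by simp
  also have "\<dots> = \<omega> ^ r"
    using omega_nonzero order by (simp add: power_int_add power_int_mult)
  finally have "\<omega> powi n = 1 \<longleftrightarrow> r = 0"
    using inj_on_eq_iff[OF inj, of r 0] r(1) d(2) by simp
  also have "\<dots> \<longleftrightarrow> int d dvd n" unfolding dvd_eq_mod_eq_0 r(2)[symmetric] by simp
  finally show ?thesis by (simp add: d(1))
qed

lemma omega_powi_eq_iff: "\<omega> powi a = \<omega> powi b \<longleftrightarrow> [a = b] (mod (int q)\<^sup>2 - 1)"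
proof -
  have "\<omega> powi a = \<omega> powi b \<longleftrightarrow> \<omega> powi (a - b) = 1"
    using omega_nonzero by (simp add: power_int_diff field_simps)
  then show ?thesis by (simp add: omega_powi_eq_1_iff cong_iff_dvd_diff)
qed

lemma nonzero_omega_powi: assumes "x \<noteq> 0" obtains n :: int where "x = \<omega> powi n"
proof -
  have "x \<in> range (\<lambda>k::nat. \<omega> ^ k)" using primitive assms by (simp add: primitive_element_def)
  then show ?thesis using that by (metis (no_types) imageE power_int_of_nat)
qed

lemma omega_powi_in_K_iff: "\<omega> powi n \<in> K \<longleftrightarrow> int q + 1 dvd n"
proof -
  have "\<omega> powi n \<in> K \<longleftrightarrow> \<omega> powi (n * int q) = \<omega> powi n"
    by (simp add: mem_K_iff power_int_mult)
  also have "\<dots> \<longleftrightarrow> (int q - 1) * (int q + 1) dvd (int q - 1) * n"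
    by (simp add: omega_powi_eq_iff cong_iff_dvd_diff power2_eq_square algebra_simps)
  also have "\<dots> \<longleftrightarrow> int q + 1 dvd n" using q_gt_1 by simp
  finally show ?thesis .
qed

end

section \<open>Additive characters and Gauss sums\<close>

lemma sum_lessThan_add_split:
  fixes g :: "nat \<Rightarrow> 'b::comm_monoid_add"
  shows "(\<Sum>i<m + n. g i) = (\<Sum>i<m. g i) + (\<Sum>i<n. g (m + i))"
  by (induction n) (simp_all add: add.assoc)

lemma abs_trace_add:
  fixes K :: "'a::{field,finite} set"
  shows "abs_trace K (x + y) = abs_trace K x + abs_trace K y"
  by (simp add: abs_trace_def sum.distrib freshmans_dream'[OF prime_CHAR_finite_field])

context quadratic_extension
begin

text \<open>Raising to the power \<open>p = CHAR('a)\<close> shifts the summands cyclically, the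
  last one returning to \<open>x\<close> since \<open>x ^ q = x\<close>.\<close>

lemma abs_trace_frobenius:
  assumes "x \<in> K"
  shows "abs_trace K x ^ CHAR('a) = abs_trace K x"
proof -
  obtain f where f: "f > 0" "q = CHAR('a) ^ f" by (rule q_CHAR_power)
  have deg: "prime_degree K = f" using f card_K by (intro prime_degree_eqI) simp
  have "abs_trace K x ^ CHAR('a) + x = x + (\<Sum>i<f. x ^ (CHAR('a) ^ Suc i))"
    unfolding abs_trace_def deg freshmans_dream_sum[OF prime_CHAR_finite_field refl]
    by (simp add: mult.commute flip: power_mult)
  also have "\<dots> = (\<Sum>i<Suc f. x ^ (CHAR('a) ^ i))"
    by (subst sum.lessThan_Suc_shift) simp
  also have "\<dots> = abs_trace K x + x"
    using assms by (simp add: abs_trace_def deg mem_K_iff flip: f(2))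
  finally show ?thesis by simp
qed

text \<open>Transitivity of the trace: the upper half of the \<open>2 * f\<close> summands is the
  lower half evaluated at \<open>x ^ q\<close>.\<close>

lemma abs_trace_UNIV: "abs_trace UNIV (x::'a) = abs_trace K (x + x ^ q)"
proof -
  obtain f where f: "f > 0" "q = CHAR('a) ^ f" by (rule q_CHAR_power)
  have deg: "prime_degree K = f" "prime_degree (UNIV :: 'a set) = f + f"
    using f card_K card_field
    by (auto intro!: prime_degree_eqI simp: power2_eq_square power_add)
  have "x ^ CHAR('a) ^ (f + i) = (x ^ q) ^ CHAR('a) ^ i" for i
    by (simp add: f(2) power_add power_mult)
  then show ?thesis
    unfolding abs_trace_add by (simp add: abs_trace_def deg sum_lessThan_add_split)
qed

text \<open>The trace is a nonzero polynomial function of degree below \<open>q\<close>, so it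
  cannot vanish on all \<open>q\<close> elements of \<open>K\<close>.\<close>

lemma abs_trace_nonzero: obtains x where "x \<in> K" "abs_trace K x \<noteq> 0"
proof -
  obtain f where f: "f > 0" "q = CHAR('a) ^ f" by (rule q_CHAR_power)
  have deg: "prime_degree K = f" using f card_K by (intro prime_degree_eqI) simp
  have p: "CHAR('a) > 1" using prime_CHAR_finite_field[where ?'a = 'a] prime_gt_1_nat by blast
  define P where "P = (\<Sum>i<f. Polynomial.monom (1::'a) (CHAR('a) ^ i))"
  have poly_P: "poly P x = abs_trace K x" for x
    by (simp add: P_def poly_sum poly_monom abs_trace_def deg)
  have "poly.coeff P (CHAR('a) ^ (f - 1)) = (\<Sum>i<f. if i = f - 1 then 1 else 0)"
    unfolding P_def coeff_sum coeff_monom using p by (intro sum.cong) auto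
  also have "\<dots> = 1" using f(1) by simp
  finally have "P \<noteq> 0" by auto
  have "degree P \<le> CHAR('a) ^ (f - 1)"
    unfolding P_def using p
    by (intro degree_sum_le order.trans[OF degree_monom_le] power_increasing) auto
  also have "\<dots> < q" unfolding f(2) using p f(1) by (intro power_strict_increasing) auto
  finally have "card {x. poly P x = 0} < card K"
    using card_poly_roots_bound[OF \<open>P \<noteq> 0\<close>] card_K by linarith
  then have "\<not> K \<subseteq> {x. poly P x = 0}" using card_mono[of "{x. poly P x = 0}" K] by auto
  then show ?thesis using that poly_P by auto
qed

abbreviation \<psi> :: "'a \<Rightarrow> complex" where "\<psi> \<equiv> canonical_add_char K"

lemma canonical_add_char_UNIV: "canonical_add_char UNIV x = \<psi> (x + x ^ q)"
  by (simp add: canonical_add_char_def abs_trace_UNIV)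

lemma add_char_add:
  assumes "x \<in> K" "y \<in> K"
  shows "\<psi> (x + y) = \<psi> x * \<psi> y"
proof -
  define p where "p = CHAR('a)"
  define a b c where "a = prime_field_lift (abs_trace K x)" and "b = prime_field_lift (abs_trace K y)"
    and "c = prime_field_lift (abs_trace K (x + y))"
  have p: "p > 0" using prime_CHAR_finite_field[where ?'a = 'a] prime_gt_0_nat by (simp add: p_def)
  have "of_nat (a + b) = (of_nat c :: 'a)"
    using assms K_closed(1)[OF assms]
    by (simp add: a_def b_def c_def prime_field_lift(2)[OF abs_trace_frobenius])
      (simp add: abs_trace_add)
  \<comment> \<open>The lifts add up only modulo \<open>p\<close>; the discrepancy
    \<open>p * k\<close> later contributes the trivial factor
    \<open>exp (2 * pi * i * k)\<close>.\<close>
  then have "[int (a + b) = int c] (mod int p)"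
    unfolding of_nat_eq_iff_cong_CHAR p_def cong_int_iff .
  from cong_sym[OF this] obtain k where "int a + int b = int c + int p * k"
    unfolding cong_iff_lin by auto
  then have "of_int (int a + int b) = (of_int (int c + int p * k) :: complex)" by metis
  then have eq: "of_nat a + of_nat b = (of_nat c + of_nat p * of_int k :: complex)" by simp
  have "\<psi> x * \<psi> y = exp (2 * of_real pi * \<i> * (of_nat a + of_nat b) / of_nat p)"
    by (simp add: canonical_add_char_def a_def b_def p_def ring_distribs add_divide_distrib flip: exp_add)
  also have "\<dots> = exp (2 * of_real pi * \<i> * of_nat c / of_nat p + 2 * of_int k * of_real pi * \<i>)"
    unfolding eq using p by (intro arg_cong[where f = exp]) (simp add: field_simps)
  also have "\<dots> = \<psi> (x + y)"
    using exp_integer_2pi[of "of_int k"]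
    by (simp add: exp_add canonical_add_char_def c_def p_def)
  finally show ?thesis by simp
qed

lemma add_char_nontrivial: obtains x where "x \<in> K" "\<psi> x \<noteq> 1"
proof -
  obtain x where x: "x \<in> K" "abs_trace K x \<noteq> 0" by (rule abs_trace_nonzero)
  define a where "a = prime_field_lift (abs_trace K x)"
  have a: "a < CHAR('a)" "of_nat a = abs_trace K x"
    using x(1) by (simp_all add: a_def prime_field_lift abs_trace_frobenius)
  have "a \<noteq> 0" using a(2) x(2) by (metis of_nat_0)
  have "\<psi> x \<noteq> 1"
  proof
    assume "\<psi> x = 1"
    then obtain n :: int where "2 * pi * real a / real CHAR('a) = of_int (2 * n) * pi"
      by (auto simp: canonical_add_char_def exp_eq_1 a_def)
    then have "real a = of_int n * real CHAR('a)" using a(1) by (simp add: field_simps)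
    then have "of_int (int a) = (of_int (n * int CHAR('a)) :: real)" by simp
    then have "int a = n * int CHAR('a)" by (simp only: of_int_eq_iff)
    then have "CHAR('a) dvd a" by (metis dvd_triv_right int_dvd_int_iff)
    then show False using a(1) \<open>a \<noteq> 0\<close> by (auto dest: dvd_imp_le)
  qed
  with x(1) that show ?thesis by blast
qed

lemma bij_K_translate: "a \<in> K \<Longrightarrow> bij_betw (\<lambda>x. x + a) K K"
  by (rule bij_betw_byWitness[where f' = "\<lambda>x. x - a"]) (auto intro: K_closed)

lemma bij_K_scale: "c \<in> K - {0} \<Longrightarrow> bij_betw ((*) c) K K"
  by (rule bij_betw_byWitness[where f' = "\<lambda>x. x / c"]) (auto intro: K_closed)

text \<open>Orthogonality: for \<open>c \<noteq> 0\<close>, scaling removes \<open>c\<close>, and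
  translating by some \<open>y\<close> with \<open>\<psi> y \<noteq> 1\<close> multiplies the sum by
  \<open>\<psi> y\<close>.\<close>

lemma add_char_sum:
  assumes c: "c \<in> K"
  shows "(\<Sum>x\<in>K. \<psi> (x * c)) = (if c = 0 then of_nat q else 0)"
proof (cases "c = 0")
  case True
  have "\<psi> 0 * \<psi> 0 = \<psi> 0" using add_char_add[of 0 0] zero_in_K by simp
  then have "\<psi> 0 = 1" by (simp add: canonical_add_char_def)
  then show ?thesis using True card_K by simp
next
  case False
  obtain y where y: "y \<in> K" "\<psi> y \<noteq> 1" by (rule add_char_nontrivial)
  have "(\<Sum>x\<in>K. \<psi> (x * c)) = (\<Sum>x\<in>K. \<psi> x)"
    using sum.reindex_bij_betw[OF bij_K_scale[of c], of \<psi>] c False by (simp add: mult.commute)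
  also have "\<dots> = 0"
  proof -
    have "(\<Sum>x\<in>K. \<psi> x) = (\<Sum>x\<in>K. \<psi> (x + y))"
      using sum.reindex_bij_betw[OF bij_K_translate[OF y(1)], of \<psi>] by simp
    also have "\<dots> = (\<Sum>x\<in>K. \<psi> x) * \<psi> y"
      by (simp add: add_char_add y(1) sum_distrib_right)
    finally show ?thesis using y(2) by simp
  qed
  finally show ?thesis using False by simp
qed

lemma mult_char_sum_eq_0:
  assumes "mult_char K \<eta>" "k \<in> K - {0}" "\<eta> k \<noteq> 1"
  shows "(\<Sum>x\<in>K - {0}. \<eta> x) = 0"
proof -
  have "(\<Sum>x\<in>K - {0}. \<eta> x) = (\<Sum>x\<in>K - {0}. \<eta> (k * x))"
    using sum.reindex_bij_betw[OF subfield_mult_nonzero_bij[OF subfield assms(2)], of \<eta>] by simp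
  also have "\<dots> = \<eta> k * (\<Sum>x\<in>K - {0}. \<eta> x)"
    using assms(1,2) by (simp add: mult_char_def sum_distrib_left)
  finally show ?thesis using assms(3) by simp
qed

text \<open>If the Gauss sum vanished, so would the whole Fourier transform of the multiplicative
  character, contradicting Fourier inversion at \<open>1\<close>.\<close>

lemma gauss_sum_nonzero:
  assumes \<eta>: "mult_char K \<eta>" and k: "k \<in> K - {0}" "\<eta> k \<noteq> 1"
  shows "gauss_sum K \<eta> \<noteq> 0"
proof
  assume zero: "gauss_sum K \<eta> = 0"
  have mult: "\<eta> (x * y) = \<eta> x * \<eta> y" if "x \<in> K - {0}" "y \<in> K - {0}" for x y
    using \<eta> that by (simp add: mult_char_def)
  have nz: "\<eta> x \<noteq> 0" if "x \<in> K - {0}" for x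
    using \<eta> that by (simp add: mult_char_def)
  define F where "F c = (\<Sum>x\<in>K - {0}. \<eta> x * \<psi> (c * x))" for c
  have F0: "F c = 0" if c: "c \<in> K" for c
  proof (cases "c = 0")
    case True
    then show ?thesis
      using mult_char_sum_eq_0[OF assms] by (simp add: F_def flip: sum_distrib_right)
  next
    case False
    then have c': "c \<in> K - {0}" using c by simp
    have "0 = (\<Sum>x\<in>K - {0}. \<eta> (c * x) * \<psi> (c * x))"
      using sum.reindex_bij_betw[OF subfield_mult_nonzero_bij[OF subfield c'], of "\<lambda>x. \<eta> x * \<psi> x"] zero
      by (simp add: gauss_sum_def)
    also have "\<dots> = \<eta> c * F c"
      unfolding F_def sum_distrib_left by (intro sum.cong) (use mult c' in auto)
    finally show ?thesis using nz[OF c'] by simp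
  qed
  have "0 = (\<Sum>c\<in>K. \<psi> (- c) * F c)" using F0 by simp
  also have "\<dots> = (\<Sum>c\<in>K. \<Sum>x\<in>K - {0}. \<eta> x * \<psi> (c * (x - 1)))"
    unfolding F_def sum_distrib_left
  proof (intro sum.cong refl)
    fix c x assume "c \<in> K" "x \<in> K - {0}"
    then have "\<psi> (- c + c * x) = \<psi> (- c) * \<psi> (c * x)" by (intro add_char_add) (auto intro: K_closed K_uminus)
    then show "\<psi> (- c) * (\<eta> x * \<psi> (c * x)) = \<eta> x * \<psi> (c * (x - 1))" by (simp add: algebra_simps)
  qed
  also have "\<dots> = (\<Sum>x\<in>K - {0}. \<eta> x * (\<Sum>c\<in>K. \<psi> (c * (x - 1))))"
    by (subst sum.swap) (simp add: sum_distrib_left)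
  also have "\<dots> = (\<Sum>x\<in>K - {0}. if x = 1 then \<eta> 1 * of_nat q else 0)"
    by (intro sum.cong refl) (simp add: add_char_sum K_closed one_in_K)
  also have "\<dots> = \<eta> 1 * of_nat q" using one_in_K by simp
  finally show False using nz[of 1] one_in_K q_gt_1 by simp
qed

section \<open>Eisenstein sums\<close>

text \<open>The classical Eisenstein sum is the case \<open>c = 1\<close>; general \<open>c\<close>
  serves to split a Gauss sum by relative trace \<open>z + z ^ q\<close>. Excluding
  \<open>z = 0\<close> matters only for \<open>c = 0\<close>.\<close>

definition eisenstein_sum :: "('a \<Rightarrow> complex) \<Rightarrow> 'a \<Rightarrow> complex" where
  "eisenstein_sum \<kappa> c = (\<Sum>z | z \<noteq> 0 \<and> z + z ^ q = c. \<kappa> z)"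

lemma eisenstein_sum_scale:
  assumes \<kappa>: "mult_char UNIV \<kappa>" and k: "k \<in> K - {0}"
  shows "eisenstein_sum \<kappa> (k * c) = \<kappa> k * eisenstein_sum \<kappa> c"
proof -
  have kq: "k ^ q = k" using k mem_K_iff by simp
  have "bij_betw ((*) k) {z. z \<noteq> 0 \<and> z + z ^ q = c} {z. z \<noteq> 0 \<and> z + z ^ q = k * c}"
    by (rule bij_betw_byWitness[where f' = "\<lambda>z. z / k"])
      (use k in \<open>auto simp: power_mult_distrib power_divide kq simp flip: distrib_left add_divide_distrib\<close>)
  from sum.reindex_bij_betw[OF this, of \<kappa>]
  have "eisenstein_sum \<kappa> (k * c) = (\<Sum>z | z \<noteq> 0 \<and> z + z ^ q = c. \<kappa> (k * z))"
    by (simp add: eisenstein_sum_def)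
  also have "\<dots> = \<kappa> k * eisenstein_sum \<kappa> c"
    unfolding eisenstein_sum_def sum_distrib_left
    by (intro sum.cong) (use \<kappa> k in \<open>auto simp: mult_char_def\<close>)
  finally show ?thesis .
qed

lemma gauss_sum_UNIV_eq:
  assumes \<kappa>: "mult_char UNIV \<kappa>" and k: "k \<in> K - {0}" "\<kappa> k \<noteq> 1"
  shows "gauss_sum UNIV \<kappa> = eisenstein_sum \<kappa> 1 * gauss_sum K \<kappa>"
proof -
  \<comment> \<open>Scaling by \<open>k\<close> fixes the trace-zero elements, so this sum equals
    \<open>\<kappa> k\<close> times itself.\<close>
  have "eisenstein_sum \<kappa> 0 = 0"
    using eisenstein_sum_scale[OF \<kappa> k(1), of 0] k(2) by simp
  have tr: "z + z ^ q \<in> K" for z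
    by (simp add: mem_K_iff frobenius_add frobenius_frobenius add.commute)
  have "gauss_sum UNIV \<kappa> = (\<Sum>z\<in>UNIV - {0}. \<kappa> z * \<psi> (z + z ^ q))"
    by (simp add: gauss_sum_def canonical_add_char_UNIV)
  also have "\<dots> = (\<Sum>c\<in>K. \<Sum>z | z \<in> UNIV - {0} \<and> z + z ^ q = c. \<kappa> z * \<psi> (z + z ^ q))"
    by (rule sum.group[symmetric]) (use tr in auto)
  also have "\<dots> = (\<Sum>c\<in>K. eisenstein_sum \<kappa> c * \<psi> c)"
    unfolding eisenstein_sum_def sum_distrib_right by (intro sum.cong) auto
  also have "\<dots> = (\<Sum>c\<in>K - {0}. eisenstein_sum \<kappa> c * \<psi> c)"
    using zero_in_K \<open>eisenstein_sum \<kappa> 0 = 0\<close> by (subst sum.remove[of _ 0]) auto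
  also have "\<dots> = (\<Sum>c\<in>K - {0}. eisenstein_sum \<kappa> 1 * (\<kappa> c * \<psi> c))"
    using eisenstein_sum_scale[OF \<kappa>, of _ 1] by (intro sum.cong) auto
  finally show ?thesis by (simp add: gauss_sum_def sum_distrib_left)
qed

text \<open>With \<open>t = a - a ^ q\<close>, which Frobenius negates, division by \<open>t\<close>
  carries the line \<open>K + a\<close> onto the elements of relative trace 1: the trace of
  \<open>(y + a) / t\<close> is \<open>(a - a ^ q) / t\<close>.\<close>

lemma line_sum:
  assumes \<kappa>: "mult_char UNIV \<kappa>" and a: "a \<notin> K"
  shows "(\<Sum>y\<in>K. \<kappa> (y + a)) = \<kappa> (a - a ^ q) * eisenstein_sum \<kappa> 1"
proof -
  define t where "t = a - a ^ q"
  have t: "t \<noteq> 0" "t ^ q = - t"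
    using a by (auto simp: t_def mem_K_iff frobenius_diff frobenius_frobenius)
  have nz: "y + a \<noteq> 0" if "y \<in> K" for y
    using a that K_uminus[of y] by (metis add.commute eq_neg_iff_add_eq_0)
  have "bij_betw (\<lambda>y. (y + a) / t) K {z::'a. z \<noteq> 0 \<and> z + z ^ q = 1}"
  proof (rule bij_betw_byWitness[where f' = "\<lambda>z. t * z - a"])
    show "(\<lambda>y. (y + a) / t) ` K \<subseteq> {z::'a. z \<noteq> 0 \<and> z + z ^ q = 1}"
    proof (intro image_subsetI CollectI conjI)
      fix y assume y: "y \<in> K"
      then show "(y + a) / t \<noteq> 0" using nz t(1) by simp
      have "(y + a) / t + ((y + a) / t) ^ q = (y + a - (y + a ^ q)) / t"
        using y by (simp add: power_divide frobenius_add mem_K_iff t(2) diff_divide_distrib add_divide_distrib)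
      also have "\<dots> = 1" using t(1) by (simp add: t_def)
      finally show "(y + a) / t + ((y + a) / t) ^ q = 1" .
    qed
    show "(\<lambda>z. t * z - a) ` {z::'a. z \<noteq> 0 \<and> z + z ^ q = 1} \<subseteq> K"
    proof (intro image_subsetI)
      fix z assume "z \<in> {z::'a. z \<noteq> 0 \<and> z + z ^ q = 1}"
      then have "z ^ q = 1 - z" by (simp add: algebra_simps)
      then have "(t * z - a) ^ q = - t * (1 - z) - a ^ q"
        by (simp add: frobenius_diff power_mult_distrib t(2))
      also have "\<dots> = t * z - a" by (simp add: t_def algebra_simps)
      finally show "t * z - a \<in> K" by (simp add: mem_K_iff)
    qed
  qed (use t(1) in auto)
  from sum.reindex_bij_betw[OF this, of "\<lambda>z. \<kappa> (t * z)"]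
  have "(\<Sum>y\<in>K. \<kappa> (y + a)) = (\<Sum>z | z \<noteq> 0 \<and> z + z ^ q = 1. \<kappa> (t * z))"
    using t(1) by simp
  also have "\<dots> = \<kappa> t * eisenstein_sum \<kappa> 1"
    unfolding eisenstein_sum_def sum_distrib_left
    by (intro sum.cong) (use \<kappa> t(1) in \<open>auto simp: mult_char_def\<close>)
  finally show ?thesis by (simp add: t_def)
qed

end

section \<open>Eighth roots of unity\<close>

definition zeta8 :: complex where
  "zeta8 = exp (2 * of_real pi * \<i> / 8)"

lemma zeta8_eq_cis: "zeta8 = cis (pi / 4)"
  by (simp add: zeta8_def cis_conv_exp)

lemma zeta8_nonzero [simp]: "zeta8 \<noteq> 0"
  by (simp add: zeta8_def)

lemma zeta8_power_2: "zeta8 ^ 2 = \<i>"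
  by (simp add: zeta8_eq_cis power2_eq_square cis_mult flip: cis_pi_half)

lemma zeta8_power_4: "zeta8 ^ 4 = - 1"
proof -
  have "zeta8 ^ 4 = (zeta8 ^ 2) ^ 2" by (simp flip: power_mult)
  then show ?thesis by (simp add: zeta8_power_2)
qed

lemma zeta8_components:
  "Re zeta8 = sqrt 2 / 2" "Im zeta8 = sqrt 2 / 2"
  "Re (zeta8 ^ 3) = - sqrt 2 / 2" "Im (zeta8 ^ 3) = sqrt 2 / 2"
proof -
  show *: "Re zeta8 = sqrt 2 / 2" "Im zeta8 = sqrt 2 / 2"
    by (simp_all add: zeta8_eq_cis cos_45 sin_45)
  have "zeta8 ^ 3 = \<i> * zeta8"
    using zeta8_power_2 by (simp add: power3_eq_cube power2_eq_square)
  then show "Re (zeta8 ^ 3) = - sqrt 2 / 2" "Im (zeta8 ^ 3) = sqrt 2 / 2"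
    using * by simp_all
qed

lemma csqrt_minus_2: "csqrt (- 2) = zeta8 + zeta8 ^ 3"
proof -
  have "csqrt (- 2) = \<i> * sqrt 2" by (simp add: csqrt_of_real_nonpos[of "- 2", simplified])
  then show ?thesis by (simp add: complex_eq_iff zeta8_components)
qed

lemma zeta8_powi_antiperiodic: "zeta8 powi (n + 4) = - (zeta8 powi n)"
  using zeta8_power_4 by (simp add: power_int_add)

lemma zeta8_powi_8_mult: "zeta8 powi (8 * n) = 1"
proof -
  have "zeta8 ^ 8 = (zeta8 ^ 4) ^ 2" by (simp flip: power_mult)
  then have "zeta8 ^ 8 = 1" by (simp add: zeta8_power_4)
  then show ?thesis using power_int_mult[of zeta8 8 n] by simp
qed

text \<open>Irrationality of the square root of 2, by parity of the multiplicity of 2 on both sides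
  of \<open>b^2 = 2 * a^2\<close>.\<close>

lemma sqrt_2_int_lin_indep:
  assumes "of_int a + of_int b * (sqrt 2 / 2) = (0::real)"
  shows "a = 0" "b = 0"
proof -
  have "of_int b * sqrt 2 = (- 2 * of_int a :: real)" using assms by (simp add: field_simps)
  from arg_cong[OF this, of "\<lambda>x. x\<^sup>2"] have "of_int (b\<^sup>2) = (of_int (2 * a\<^sup>2) :: real)"
    by (simp add: power_mult_distrib)
  then have sq: "b\<^sup>2 = 2 * a\<^sup>2" by (simp only: of_int_eq_iff)
  show "a = 0"
  proof (rule ccontr)
    assume "a \<noteq> 0"
    with sq have "b \<noteq> 0" by fastforce
    have "multiplicity 2 (b\<^sup>2) = 2 * multiplicity 2 b"
      using \<open>b \<noteq> 0\<close> by (simp add: prime_elem_multiplicity_power_distrib)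
    moreover have "multiplicity 2 (2 * a\<^sup>2) = 1 + 2 * multiplicity 2 a"
      using \<open>a \<noteq> 0\<close>
      by (simp add: prime_elem_multiplicity_mult_distrib prime_elem_multiplicity_power_distrib)
    ultimately have "2 * multiplicity 2 b = 1 + 2 * multiplicity 2 a" using sq by metis
    then show False by presburger
  qed
  with sq show "b = 0" by simp
qed

lemma zeta8_int_lin_indep:
  assumes "of_int a + of_int b * zeta8 + of_int c * zeta8 ^ 2 + of_int d * zeta8 ^ 3 = 0"
  shows "a = 0" "b = 0" "c = 0" "d = 0"
proof -
  have "of_int a + of_int (b - d) * (sqrt 2 / 2) = 0"
    using arg_cong[OF assms, of Re] by (simp add: zeta8_components zeta8_power_2 field_simps)
  then have 1: "a = 0" "b - d = 0" by (rule sqrt_2_int_lin_indep)+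
  have "of_int c + of_int (b + d) * (sqrt 2 / 2) = 0"
    using arg_cong[OF assms, of Im] by (simp add: zeta8_components zeta8_power_2 field_simps)
  then have 2: "c = 0" "b + d = 0" by (rule sqrt_2_int_lin_indep)+
  from 1 2 show "a = 0" "b = 0" "c = 0" "d = 0" by auto
qed

section \<open>Antiperiodic functions as linear images of the powers of \<open>zeta8\<close>\<close>

definition antiperiodic4 :: "(int \<Rightarrow> 'b::ring_1) \<Rightarrow> bool" where
  "antiperiodic4 \<phi> \<longleftrightarrow> (\<forall>n. \<phi> (n + 4) = - \<phi> n)"

text \<open>For \<open>j\<close> from 0 to 3 this is the coordinate of \<open>zeta8 powi n\<close>
  at \<open>zeta8 ^ j\<close>, as \<open>zeta8 ^ (j + 4) = - (zeta8 ^ j)\<close>.\<close>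

definition coord8 :: "int \<Rightarrow> int \<Rightarrow> int" where
  "coord8 j n = (if [n = j] (mod 8) then 1 else if [n = j + 4] (mod 8) then - 1 else 0)"

lemma antiperiodic4_coord8: "antiperiodic4 (coord8 j)"
  unfolding antiperiodic4_def
proof
  fix n
  have "8 dvd n + 4 - j \<longleftrightarrow> 8 dvd n - (j + 4)" by presburger
  moreover have "\<not> (8 dvd n - j \<and> 8 dvd n - (j + 4))" by presburger
  ultimately show "coord8 j (n + 4) = - coord8 j n"
    by (auto simp: coord8_def cong_iff_dvd_diff)
qed

lemma antiperiodic4_mod_8:
  assumes "antiperiodic4 \<phi>"
  shows "\<phi> (n mod 8) = \<phi> n"
proof -
  have step: "\<phi> (k + 8) = \<phi> k" for k
    using assms[unfolded antiperiodic4_def, rule_format, of "k + 4"]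
      assms[unfolded antiperiodic4_def, rule_format, of k] by (simp add: add.commute)
  have "\<phi> (r + 8 * k) = \<phi> r" for r k
  proof (induction k rule: int_induct[where k = 0])
    case (step1 k)
    then show ?case using step[of "r + 8 * k"] by (simp add: algebra_simps)
  next
    case (step2 k)
    then show ?case using step[of "r + 8 * (k - 1)"] by (simp add: algebra_simps)
  qed simp
  from this[of "n mod 8" "n div 8"] show ?thesis by simp
qed

lemma antiperiodic4_expand:
  assumes "antiperiodic4 \<phi>"
  shows "\<phi> n = of_int (coord8 0 n) * \<phi> 0 + of_int (coord8 1 n) * \<phi> 1
    + of_int (coord8 2 n) * \<phi> 2 + of_int (coord8 3 n) * \<phi> 3"
proof -
  have neg: "\<phi> 4 = - \<phi> 0" "\<phi> 5 = - \<phi> 1" "\<phi> 6 = - \<phi> 2" "\<phi> 7 = - \<phi> 3"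
    using assms[unfolded antiperiodic4_def, rule_format, of 0]
      assms[unfolded antiperiodic4_def, rule_format, of 1]
      assms[unfolded antiperiodic4_def, rule_format, of 2]
      assms[unfolded antiperiodic4_def, rule_format, of 3] by simp_all
  have r: "n mod 8 = 0 \<or> n mod 8 = 1 \<or> n mod 8 = 2 \<or> n mod 8 = 3 \<or>
      n mod 8 = 4 \<or> n mod 8 = 5 \<or> n mod 8 = 6 \<or> n mod 8 = 7" by presburger
  have "\<phi> (n mod 8) = of_int (coord8 0 n) * \<phi> 0 + of_int (coord8 1 n) * \<phi> 1
    + of_int (coord8 2 n) * \<phi> 2 + of_int (coord8 3 n) * \<phi> 3"
    using r by (elim disjE) (simp_all add: coord8_def cong_def neg)
  then show ?thesis by (simp only: antiperiodic4_mod_8[OF assms])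
qed

text \<open>Since \<open>1, \<zeta>, \<zeta>\<^sup>2, \<zeta>\<^sup>3\<close> are linearly independent over the rationals, every integer relation between
  powers of \<open>\<zeta>\<close> is preserved by \<open>\<zeta>\<^sup>n \<mapsto> \<phi> n\<close> for antiperiodic \<open>\<phi>\<close>. This replaces Fourier inversion
  over the powers of \<open>\<chi>\<^sub>8\<close> (and the Galois conjugates of the character sums).\<close>

lemma zeta8_relation_antiperiodic:
  fixes \<phi> :: "int \<Rightarrow> int"
  assumes \<phi>: "antiperiodic4 \<phi>"
    and rel: "(\<Sum>x\<in>X. of_int (g x) * zeta8 powi (i x)) =
      of_int a1 * zeta8 powi n1 + of_int a2 * zeta8 powi n2
      + of_int a3 * zeta8 powi n3 + of_int a4 * zeta8 powi n4"
  shows "(\<Sum>x\<in>X. g x * \<phi> (i x)) = a1 * \<phi> n1 + a2 * \<phi> n2 + a3 * \<phi> n3 + a4 * \<phi> n4"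
proof -
  \<comment> \<open>\<open>A j\<close> is the coordinate at \<open>zeta8 ^ j\<close> of the
    difference of the two sides of \<open>rel\<close>, hence 0 by independence.\<close>
  define A where "A j = (\<Sum>x\<in>X. g x * coord8 j (i x))
    - (a1 * coord8 j n1 + a2 * coord8 j n2 + a3 * coord8 j n3 + a4 * coord8 j n4)" for j
  have Z: "zeta8 powi n = of_int (coord8 0 n) + of_int (coord8 1 n) * zeta8
    + of_int (coord8 2 n) * zeta8 ^ 2 + of_int (coord8 3 n) * zeta8 ^ 3" for n
    using antiperiodic4_expand[of "\<lambda>n. zeta8 powi n" n]
    by (simp add: antiperiodic4_def zeta8_powi_antiperiodic)
  have "(\<Sum>x\<in>X. of_int (g x) * zeta8 powi (i x)) =
      of_int (\<Sum>x\<in>X. g x * coord8 0 (i x)) + of_int (\<Sum>x\<in>X. g x * coord8 1 (i x)) * zeta8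
      + of_int (\<Sum>x\<in>X. g x * coord8 2 (i x)) * zeta8 ^ 2
      + of_int (\<Sum>x\<in>X. g x * coord8 3 (i x)) * zeta8 ^ 3"
    unfolding Z by (simp add: sum_distrib_right sum.distrib distrib_left mult.assoc)
  with rel have "of_int (A 0) + of_int (A 1) * zeta8 + of_int (A 2) * zeta8 ^ 2
      + of_int (A 3) * zeta8 ^ 3 = 0"
    unfolding A_def Z[of n1] Z[of n2] Z[of n3] Z[of n4] by (simp add: algebra_simps)
  from zeta8_int_lin_indep[OF this] have "A 0 = 0" "A 1 = 0" "A 2 = 0" "A 3 = 0" .
  then have S: "(\<Sum>x\<in>X. g x * coord8 j (i x)) =
      a1 * coord8 j n1 + a2 * coord8 j n2 + a3 * coord8 j n3 + a4 * coord8 j n4"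
    if "j \<in> {0, 1, 2, 3}" for j
    using that by (auto simp: A_def)
  have E: "\<phi> n = coord8 0 n * \<phi> 0 + coord8 1 n * \<phi> 1 + coord8 2 n * \<phi> 2 + coord8 3 n * \<phi> 3" for n
    using antiperiodic4_expand[OF \<phi>, of n] by simp
  have "(\<Sum>x\<in>X. g x * \<phi> (i x)) = (\<Sum>x\<in>X. g x * (coord8 0 (i x) * \<phi> 0
      + coord8 1 (i x) * \<phi> 1 + coord8 2 (i x) * \<phi> 2 + coord8 3 (i x) * \<phi> 3))"
    by (rule sum.cong[OF refl], rule arg_cong[OF E])
  also have "\<dots> =
      (\<Sum>x\<in>X. g x * coord8 0 (i x)) * \<phi> 0 + (\<Sum>x\<in>X. g x * coord8 1 (i x)) * \<phi> 1
      + (\<Sum>x\<in>X. g x * coord8 2 (i x)) * \<phi> 2 + (\<Sum>x\<in>X. g x * coord8 3 (i x)) * \<phi> 3"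
    by (simp add: sum_distrib_right sum.distrib distrib_left mult.assoc)
  also have "\<dots> = a1 * \<phi> n1 + a2 * \<phi> n2 + a3 * \<phi> n3 + a4 * \<phi> n4"
    unfolding E[of n1] E[of n2] E[of n3] E[of n4] by (simp add: S algebra_simps)
  finally show ?thesis .
qed

lemma zeta8_powi_eq_imp_cong:
  assumes "zeta8 powi a = zeta8 powi b"
  shows "[a = b] (mod 8)"
proof -
  have "coord8 b a = coord8 b b"
    using zeta8_relation_antiperiodic[OF antiperiodic4_coord8[of b],
        where X = "{()}" and g = "\<lambda>_. 1" and i = "\<lambda>_. a"
        and ?a1.0 = 1 and ?n1.0 = b and ?a2.0 = 0 and ?a3.0 = 0 and ?a4.0 = 0] assms by simp
  then show ?thesis by (simp add: coord8_def cong_def split: if_splits)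
qed

section \<open>The octic character\<close>

lemma card_int_residue_class:
  assumes "0 \<le> k" "k < (4::int)"
  shows "card {t \<in> {0..<4 * int n}. t mod 4 = k} = n"
proof -
  have "bij_betw (\<lambda>u. 4 * int u + k) {..<n} {t \<in> {0..<4 * int n}. t mod 4 = k}"
    by (rule bij_betw_byWitness[where f' = "\<lambda>t. nat (t div 4)"]) (use assms in auto)
  from bij_betw_same_card[OF this] show ?thesis by simp
qed

locale octic_character = quadratic_extension K q \<omega>
  for K :: "'a::{field,finite} set" and q :: nat and \<omega> :: 'a +
  fixes chi8 :: "'a \<Rightarrow> complex"
  assumes q_mod_8: "q mod 8 = 3"
    and mult_char: "mult_char UNIV chi8"
    and chi8_omega: "chi8 \<omega> = zeta8"
begin

lemma chi8_mult: "x \<noteq> 0 \<Longrightarrow> y \<noteq> 0 \<Longrightarrow> chi8 (x * y) = chi8 x * chi8 y"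
  and chi8_nonzero: "x \<noteq> 0 \<Longrightarrow> chi8 x \<noteq> 0"
  using mult_char by (auto simp: mult_char_def)

lemma chi8_divide:
  assumes "x \<noteq> 0" "y \<noteq> 0"
  shows "chi8 (x / y) = chi8 x / chi8 y"
  using chi8_mult[of "x / y" y] assms chi8_nonzero[of y] by (simp add: field_simps)

lemma chi8_1: "chi8 1 = 1"
  using chi8_divide[of 1 1] chi8_nonzero[of 1] by simp

lemma chi8_omega_powi: "chi8 (\<omega> powi n) = zeta8 powi n"
proof -
  have nat: "chi8 (\<omega> ^ k) = zeta8 ^ k" for k
    by (induction k) (simp_all add: chi8_1 chi8_mult omega_nonzero chi8_omega)
  show ?thesis
  proof (cases n rule: int_cases2)
    case (nonneg k)
    then show ?thesis by (simp add: nat)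
  next
    case (nonpos k)
    then show ?thesis
      using chi8_divide[of 1 "\<omega> ^ k"] omega_nonzero
      by (simp add: nat chi8_1 power_int_minus inverse_eq_divide)
  qed
qed

lemma q_eq: obtains j where "int q = 8 * j + 3"
proof
  have "q = 8 * (q div 8) + 3" using mult_div_mod_eq[of 8 q] q_mod_8 by simp
  then show "int q = 8 * int (q div 8) + 3" by linarith
qed

lemma chi8_power_8: "x \<noteq> 0 \<Longrightarrow> chi8 x ^ 8 = 1"
proof -
  assume "x \<noteq> 0"
  then obtain n where "x = \<omega> powi n" by (rule nonzero_omega_powi)
  then have "chi8 x ^ 8 = zeta8 powi (8 * n)"
    unfolding mult.commute[of 8 n] by (simp add: chi8_omega_powi power_int_mult)
  then show ?thesis by (simp only: zeta8_powi_8_mult)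
qed

text \<open>\<open>x * x ^ q\<close> is the power \<open>x ^ (q + 1)\<close>, and
  \<open>q + 1\<close> is 4 modulo 8.\<close>

lemma chi8_norm:
  assumes "x \<noteq> 0"
  shows "chi8 (x * x ^ q) = chi8 x ^ 4"
proof -
  obtain j where j: "q = 8 * j + 3" using q_mod_8 by (metis mult_div_mod_eq)
  have pow: "chi8 (x ^ k) = chi8 x ^ k" for k
    using assms by (induction k) (simp_all add: chi8_1 chi8_mult)
  have "chi8 (x * x ^ q) = chi8 x ^ Suc q" by (simp add: pow flip: power_Suc)
  also have "Suc q = 8 * j + 4" by (simp add: j)
  also have "chi8 x ^ (8 * j + 4) = chi8 x ^ 4"
    using chi8_power_8[OF assms] by (simp add: power_add power_mult)
  finally show ?thesis .
qed

lemma chi8_minus_1: "chi8 (- 1) = - 1"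
proof -
  obtain j where j: "int q = 8 * j + 3" by (rule q_eq)
  \<comment> \<open>This is \<open>(q^2 - 1) / 2\<close>, so \<open>\<omega> powi n\<close> is the
    square root of 1 other than 1. Both inner factors can be taken odd, whence \<open>n\<close> is 4
    modulo 8.\<close>
  define n where "n = 4 * ((4 * j + 1) * (2 * j + 1))"
  have n: "2 * n = (int q)\<^sup>2 - 1" by (simp add: n_def j power2_eq_square algebra_simps)
  have "(\<omega> powi n) ^ 2 = \<omega> powi (2 * n)" by (simp add: power_int_mult mult.commute)
  also have "\<dots> = 1" unfolding omega_powi_eq_1_iff n by simp
  finally have "(\<omega> powi n)\<^sup>2 = 1" .
  moreover have "\<omega> powi n \<noteq> 1"
  proof
    assume "\<omega> powi n = 1"
    then have "2 * n dvd n" by (simp add: omega_powi_eq_1_iff n)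
    then have "n = 0"
    proof (elim dvdE)
      fix k assume "n = 2 * n * k"
      then have "n * (1 - 2 * k) = 0" by (simp add: algebra_simps)
      moreover have "1 - 2 * k \<noteq> 0" by presburger
      ultimately show "n = 0" by simp
    qed
    then have "(4 * j + 1) * (2 * j + 1) = 0" by (simp add: n_def)
    moreover have "4 * j + 1 \<noteq> 0" "2 * j + 1 \<noteq> 0" by presburger+
    ultimately show False by simp
  qed
  ultimately have "\<omega> powi n = - 1" by (simp add: power2_eq_1_iff)
  then have "chi8 (- 1) = zeta8 powi n" using chi8_omega_powi by metis
  also have "n = 8 * (4 * j * j + 3 * j) + 4" by (simp add: n_def algebra_simps)
  finally show ?thesis
    by (simp only: zeta8_powi_antiperiodic zeta8_powi_8_mult)
qed

text \<open>Nonzero elements of \<open>K\<close> are \<open>\<omega> powi ((q + 1) * c)\<close>. As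
  \<open>q + 1\<close> is 4 modulo 8, \<open>chi8\<close> takes the value
  \<open>(- 1) powi c\<close>, and since \<open>q - 1\<close> is even, the parity of
  \<open>c\<close> detects squares.\<close>

lemma chi8_K_eq_quad_char:
  assumes "x \<in> K - {0}"
  shows "chi8 x = quad_char K x"
proof -
  obtain j where j: "int q = 8 * j + 3" by (rule q_eq)
  obtain n where n: "x = \<omega> powi n" using assms nonzero_omega_powi by blast
  then obtain c where c: "n = (int q + 1) * c" using assms omega_powi_in_K_iff by (auto simp: dvd_def)
  have chi: "chi8 x = zeta8 powi (8 * (j * c) + 4 * c)"
    unfolding n chi8_omega_powi by (rule arg_cong[where f = "(powi) zeta8"]) (simp add: c j algebra_simps)
  also have "\<dots> = (- 1) powi c"
    by (simp add: power_int_add zeta8_powi_8_mult) (simp add: power_int_mult zeta8_power_4)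
  finally have chi: "chi8 x = (if even c then 1 else - 1)"
    by (simp add: power_int_minus_left)
  have "x \<in> nonzero_squares K \<longleftrightarrow> even c"
  proof
    assume "x \<in> nonzero_squares K"
    then obtain y where y: "y \<in> K" "y \<noteq> 0" "x = y\<^sup>2" by (auto simp: nonzero_squares_def)
    then obtain b where b: "y = \<omega> powi b" using nonzero_omega_powi by blast
    with y(1) obtain d where d: "b = (int q + 1) * d" using omega_powi_in_K_iff by (auto simp: dvd_def)
    have "\<omega> powi n = \<omega> powi (b * 2)" using y(3) n b by (simp add: power_int_mult)
    then have "(int q + 1) * (int q - 1) dvd (int q + 1) * (c - 2 * d)"
      by (simp add: omega_powi_eq_iff cong_iff_dvd_diff c d power2_eq_square algebra_simps)
    then have "int q - 1 dvd c - 2 * d" by simp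
    moreover have "even (int q - 1)" by (simp add: j)
    ultimately have "even (c - 2 * d)" using dvd_trans by blast
    then show "even c" by simp
  next
    assume "even c"
    then obtain d where d: "c = 2 * d" by (auto elim: evenE)
    have "n = ((int q + 1) * d) * 2" by (simp add: c d)
    then have "x = (\<omega> powi ((int q + 1) * d))\<^sup>2"
      by (simp only: n power_int_mult power_int_numeral)
    moreover have "\<omega> powi ((int q + 1) * d) \<in> K" by (simp add: omega_powi_in_K_iff)
    ultimately show "x \<in> nonzero_squares K" using omega_nonzero by (auto simp: nonzero_squares_def)
  qed
  with chi assms show ?thesis by (simp add: quad_char_def)
qed

lemma chi8_nontrivial_on_K: obtains k where "k \<in> K - {0}" "chi8 k \<noteq> 1"
proof
  show "- 1 \<in> K - {0}" using K_uminus[OF one_in_K] by simp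
qed (simp add: chi8_minus_1)

text \<open>Both expressions for the large Gauss sum contain the nonzero factor
  \<open>gauss_sum K chi8\<close>, which cancels.\<close>

lemma eisenstein_sum_chi8:
  assumes "gauss_sum UNIV chi8 = gauss_sum K (quad_char K) * E"
  shows "eisenstein_sum chi8 1 = E"
proof -
  obtain k where k: "k \<in> K - {0}" "chi8 k \<noteq> 1" by (rule chi8_nontrivial_on_K)
  have "gauss_sum K chi8 = gauss_sum K (quad_char K)"
    unfolding gauss_sum_def by (intro sum.cong) (auto simp: chi8_K_eq_quad_char)
  moreover have "gauss_sum K chi8 \<noteq> 0"
    using mult_char k by (intro gauss_sum_nonzero[of _ k]) (auto simp: mult_char_def)
  ultimately show ?thesis
    using gauss_sum_UNIV_eq[OF mult_char k] assms by simp
qed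

section \<open>Character sums and index distribution on the line \<open>1 + x * A\<close>\<close>

lemma line_nonzero:
  assumes "A \<notin> K" "x \<in> K"
  shows "1 + x * A \<noteq> 0"
proof
  assume eq: "1 + x * A = 0"
  then have "x \<noteq> 0" by auto
  have "x * A = - 1" using eq by (simp only: eq_neg_iff_add_eq_0 add.commute)
  with \<open>x \<noteq> 0\<close> have "A = - 1 / x" by (metis nonzero_mult_div_cancel_left)
  with assms show False using K_closed(4)[OF K_uminus[OF one_in_K]] by blast
qed

text \<open>Factoring out \<open>A\<close> leaves the line through \<open>1 / A\<close> in direction
  \<open>K\<close>; the norm \<open>A * A ^ q\<close> in the denominator of
  \<open>1 / A - (1 / A) ^ q\<close> accounts for \<open>chi8 A ^ 4\<close>.\<close>

lemma chi8_sum_line: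
  assumes A: "A \<notin> K"
  shows "(\<Sum>x\<in>K. chi8 (1 + x * A)) =
    chi8 A * chi8 (A ^ q - A) / chi8 A ^ 4 * eisenstein_sum chi8 1"
proof -
  have A0: "A \<noteq> 0" "A ^ q - A \<noteq> 0"
    using A zero_in_K by (blast, simp add: mem_K_iff)
  have inv: "1 / A \<notin> K"
  proof
    assume "1 / A \<in> K"
    from K_closed(4)[OF one_in_K this] show False using A by simp
  qed
  have "(\<Sum>x\<in>K. chi8 (1 + x * A)) = (\<Sum>x\<in>K. chi8 A * chi8 (x + 1 / A))"
  proof (intro sum.cong refl)
    fix x assume "x \<in> K"
    have eq: "1 + x * A = A * (x + 1 / A)" using A0 by (simp add: distrib_left mult.commute)
    then have "x + 1 / A \<noteq> 0" using line_nonzero[OF A \<open>x \<in> K\<close>] by auto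
    with A0 show "chi8 (1 + x * A) = chi8 A * chi8 (x + 1 / A)"
      unfolding eq by (intro chi8_mult)
  qed
  also have "\<dots> = chi8 A * (chi8 (1 / A - (1 / A) ^ q) * eisenstein_sum chi8 1)"
    by (simp only: sum_distrib_left[symmetric] line_sum[OF mult_char inv])
  also have "1 / A - (1 / A) ^ q = (A ^ q - A) / (A * A ^ q)"
    unfolding power_one_over using diff_frac_eq[of A "A ^ q" 1 1] A0 by simp
  also have "chi8 \<dots> = chi8 (A ^ q - A) / chi8 A ^ 4"
    using A0 by (simp add: chi8_divide chi8_norm)
  finally show ?thesis by simp
qed

text \<open>Substituting \<open>y = 1 / (x - s)\<close> turns the quadratic twist of a line sum into another line sum,
  because the octic character restricts to the quadratic one on the subfield.\<close>

lemma chi8_sum_line_twisted: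
  assumes A: "A \<notin> K" and s: "s \<in> K"
  shows "(\<Sum>x\<in>K. quad_char K (x - s) * chi8 (1 + x * A)) =
    - (chi8 (1 + s * A) ^ 5 * chi8 (A ^ q - A) * eisenstein_sum chi8 1) - chi8 A"
proof -
  define u where "u = 1 + s * A"
  \<comment> \<open>Chosen so that
    \<open>(1 + x * A) / (x - s) = u * (1 / (x - s) + a)\<close>.\<close>
  define a where "a = A / u"
  have u0: "u \<noteq> 0" using line_nonzero[OF A s] by (simp add: u_def)
  have A0: "A \<noteq> 0" "A ^ q - A \<noteq> 0"
    using A zero_in_K by (blast, simp add: mem_K_iff)
  have uq: "u ^ q = 1 + s * A ^ q"
    using s by (simp add: u_def frobenius_add power_mult_distrib mem_K_iff)
  have a_diff: "a - a ^ q = - 1 * (A ^ q - A) / (u * u ^ q)"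
  proof -
    have "a - a ^ q = (A * u ^ q - A ^ q * u) / (u * u ^ q)"
      unfolding a_def power_divide using diff_frac_eq[of u "u ^ q" A "A ^ q"] u0 by simp
    also have "A * u ^ q - A ^ q * u = - 1 * (A ^ q - A)"
      unfolding uq by (simp add: u_def algebra_simps)
    finally show ?thesis .
  qed
  have a: "a \<notin> K"
  proof
    assume "a \<in> K"
    then have "a - a ^ q = 0" by (simp add: mem_K_iff)
    then show False unfolding a_diff using A0 u0 by simp
  qed
  have chi_a: "chi8 (a - a ^ q) = - chi8 (A ^ q - A) / chi8 u ^ 4"
  proof -
    have nz: "- 1 * (A ^ q - A) \<noteq> 0" "u * u ^ q \<noteq> 0" using A0(2) u0 by auto
    show ?thesis
      unfolding a_diff chi8_divide[OF nz] chi8_norm[OF u0]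
      using chi8_mult[of "- 1" "A ^ q - A"] A0(2) by (simp add: chi8_minus_1)
  qed
  have u8: "chi8 u ^ 5 = chi8 u / chi8 u ^ 4"
  proof -
    have "chi8 u ^ 5 * chi8 u ^ 4 = chi8 u * chi8 u ^ 8" by (simp add: eval_nat_numeral)
    then show ?thesis using chi8_power_8[OF u0] chi8_nonzero[OF u0] by (simp add: field_simps)
  qed
  have bij: "bij_betw (\<lambda>x. 1 / (x - s)) (K - {s}) (K - {0})"
    by (rule bij_betw_byWitness[where f' = "\<lambda>y. s + 1 / y"])
      (use s in \<open>auto intro!: K_closed one_in_K\<close>)
  have "(\<Sum>x\<in>K. quad_char K (x - s) * chi8 (1 + x * A)) =
      (\<Sum>x\<in>K - {s}. quad_char K (x - s) * chi8 (1 + x * A))"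
    using s by (subst sum.remove[of _ s]) (auto simp: quad_char_def)
  also have "\<dots> = (\<Sum>x\<in>K - {s}. chi8 u * chi8 (1 / (x - s) + a))"
  proof (intro sum.cong refl)
    fix x assume "x \<in> K - {s}"
    then have x: "x \<in> K" "x - s \<noteq> 0" "x - s \<in> K - {0}" using s K_closed(2) by auto
    have nz: "1 + x * A \<noteq> 0" using line_nonzero[OF A x(1)] .
    \<comment> \<open>The quadratic character is its own inverse, so multiplying by it is dividing
      by \<open>chi8 (x - s)\<close>.\<close>
    have "quad_char K (x - s) * chi8 (1 + x * A) = chi8 (1 + x * A) / chi8 (x - s)"
      unfolding chi8_K_eq_quad_char[OF x(3)] using x(2) by (auto simp: quad_char_def)
    also have "\<dots> = chi8 ((1 + x * A) / (x - s))" using nz x(2) by (simp add: chi8_divide)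
    also have eq: "(1 + x * A) / (x - s) = u * (1 / (x - s) + a)"
    proof -
      have "u * (1 / (x - s) + a) = u / (x - s) + A" using u0 by (simp add: a_def field_simps)
      also have "\<dots> = (u + A * (x - s)) / (x - s)" using x(2) by (simp add: add_divide_distrib)
      also have "u + A * (x - s) = 1 + x * A" by (simp add: u_def algebra_simps)
      finally show ?thesis by simp
    qed
    also have "chi8 \<dots> = chi8 u * chi8 (1 / (x - s) + a)"
      using eq nz x(2) u0 by (intro chi8_mult) auto
    finally show "quad_char K (x - s) * chi8 (1 + x * A) = chi8 u * chi8 (1 / (x - s) + a)" .
  qed
  also have "\<dots> = chi8 u * (\<Sum>y\<in>K - {0}. chi8 (y + a))"
    using sum.reindex_bij_betw[OF bij, of "\<lambda>y. chi8 (y + a)"] by (simp flip: sum_distrib_left)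
  \<comment> \<open>The missing \<open>y = 0\<close> corresponds to \<open>x\<close> at infinity and
    causes the final term \<open>- chi8 A\<close>.\<close>
  also have "(\<Sum>y\<in>K - {0}. chi8 (y + a)) = (\<Sum>y\<in>K. chi8 (y + a)) - chi8 a"
    using zero_in_K by (simp add: sum_diff1)
  also have "chi8 u * \<dots> = chi8 u * (- chi8 (A ^ q - A) / chi8 u ^ 4 * eisenstein_sum chi8 1) - chi8 u * chi8 a"
    unfolding line_sum[OF mult_char a] chi_a by (simp add: right_diff_distrib)
  also have "chi8 u * chi8 a = chi8 A"
    using u0 A0 chi8_nonzero[OF u0] by (simp add: a_def chi8_divide)
  finally show ?thesis unfolding u_def[symmetric] u8 by simp
qed

text \<open>The elements \<open>1 + x * A\<close> together with \<open>A\<close> represent the points of the projective line, that is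
  the cosets of the multiplicative group of the subfield.\<close>

lemma line_index_bij:
  assumes A: "\<omega> powi l \<notin> K" and i: "\<And>x. x \<in> K \<Longrightarrow> \<omega> powi (i x) = 1 + x * \<omega> powi l"
  shows "bij_betw (\<lambda>x. i x mod (int q + 1)) K ({0..<int q + 1} - {l mod (int q + 1)})"
proof -
  define A where "A = \<omega> powi l"
  have AK: "A \<notin> K" using assms by (simp add: A_def)
  \<comment> \<open>Indices congruent modulo \<open>q + 1\<close> mean the same coset of the
    multiplicative group of \<open>K\<close>, that is, the same projective point.\<close>
  have ratio: "\<exists>c\<in>K. \<omega> powi a = c * \<omega> powi b" if "a mod (int q + 1) = b mod (int q + 1)" for a b
  proof
    have "int q + 1 dvd a - b" using that by (simp add: mod_eq_dvd_iff)
    then show "\<omega> powi (a - b) \<in> K" by (simp add: omega_powi_in_K_iff)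
    show "\<omega> powi a = \<omega> powi (a - b) * \<omega> powi b"
      using omega_nonzero by (simp flip: power_int_add)
  qed
  have inj: "inj_on (\<lambda>x. i x mod (int q + 1)) K"
  proof (rule inj_onI)
    fix x y assume xy: "x \<in> K" "y \<in> K" "i x mod (int q + 1) = i y mod (int q + 1)"
    then obtain c where c: "c \<in> K" "1 + x * A = c * (1 + y * A)"
      using ratio[OF xy(3)] i[OF xy(1)] i[OF xy(2)] by (auto simp: A_def)
    then have eq: "(x - c * y) * A = c - 1" by (simp add: algebra_simps)
    have "x - c * y = 0"
    proof (rule ccontr)
      assume "x - c * y \<noteq> 0"
      with eq have "A = (c - 1) / (x - c * y)" by (simp add: field_simps)
      then show False using AK xy c(1) one_in_K by (auto intro: K_closed)
    qed
    with eq show "x = y" by simp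
  qed
  have "i x mod (int q + 1) \<noteq> l mod (int q + 1)" if x: "x \<in> K" for x
  proof
    assume "i x mod (int q + 1) = l mod (int q + 1)"
    then obtain c where c: "c \<in> K" "1 + x * A = c * A" using ratio[of "i x" l] i[OF x] by (auto simp: A_def)
    then have "(c - x) * A = 1" by (simp add: algebra_simps)
    then have "A = 1 / (c - x)" by (cases "c - x = 0") (simp_all add: field_simps)
    then show False using AK x c(1) one_in_K by (auto intro: K_closed)
  qed
  then have sub: "(\<lambda>x. i x mod (int q + 1)) ` K \<subseteq> {0..<int q + 1} - {l mod (int q + 1)}"
    using pos_mod_bound[of "int q + 1"] by (intro image_subsetI) simp
  have "card ({0..<int q + 1} - {l mod (int q + 1)}) = q"
    using pos_mod_bound[of "int q + 1" l] by (subst card_Diff_singleton) simp_all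
  then have "(\<lambda>x. i x mod (int q + 1)) ` K = {0..<int q + 1} - {l mod (int q + 1)}"
    using sub card_image[OF inj] card_K by (intro card_seteq) auto
  with inj show ?thesis by (simp add: bij_betw_def)
qed

text \<open>Each class modulo 4 contains \<open>n\<close> of the residues modulo
  \<open>q + 1 = 4 * n\<close>. The line hits every residue once except that of \<open>l\<close>,
  whose class loses one.\<close>

lemma card_line_index_mod_4:
  assumes A: "\<omega> powi l \<notin> K" and i: "\<And>x. x \<in> K \<Longrightarrow> \<omega> powi (i x) = 1 + x * \<omega> powi l"
    and n: "q + 1 = 4 * n"
  shows "int (card {x \<in> K. [i x = k] (mod 4)}) = int n - of_bool ([l = k] (mod 4))"
proof -
  define Q where "Q = int q + 1"
  have Q: "Q = 4 * int n" using n by (simp add: Q_def)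
  have n0: "n > 0" using n by simp
  have mm: "(a mod Q) mod 4 = a mod 4" for a by (simp add: Q mod_mod_cancel)
  define T where "T = {t \<in> {0..<Q}. t mod 4 = k mod 4}"
  have "card {x \<in> K. [i x = k] (mod 4)} = card (T - {l mod Q})"
  proof (rule bij_betw_same_card[where f = "\<lambda>x. i x mod Q"])
    show "bij_betw (\<lambda>x. i x mod Q) {x \<in> K. [i x = k] (mod 4)} (T - {l mod Q})"
      using bij_betw_Collect[OF line_index_bij[OF A i, folded Q_def], where P = "\<lambda>x. [i x = k] (mod 4)"
          and Q = "\<lambda>t. t mod 4 = k mod 4"] 
      by (simp add: T_def cong_def mm set_diff_eq conj_ac)
  qed
  moreover have "l mod Q \<in> T \<longleftrightarrow> [l = k] (mod 4)"
  proof -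
    have "Q > 0" using n0 Q by simp
    then show ?thesis by (simp add: T_def mm cong_def)
  qed
  moreover have "card T = n"
    using card_int_residue_class[of "k mod 4" n] by (simp add: T_def Q)
  moreover have "finite T" unfolding T_def by (rule finite_subset[of _ "{0..<Q}"]) auto
  ultimately show ?thesis using n0 by (auto simp: card_Diff_singleton_if of_nat_diff)
qed

end

section \<open>Intersection numbers\<close>

text \<open>The indicator of four consecutive classes rescaled to values 1 and -1, which makes it
  antiperiodic.\<close>

definition sign8 :: "int \<Rightarrow> int" where
  "sign8 n = (if n mod 8 < 4 then 1 else - 1)"

lemma antiperiodic4_sign8: "antiperiodic4 (\<lambda>n. sign8 (n - h))"
  unfolding antiperiodic4_def
proof
  fix n
  have "(d + 4) mod 8 < 4 \<longleftrightarrow> \<not> d mod 8 < 4" for d :: int by presburger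
  from this[of "n - h"] show "sign8 (n + 4 - h) = - sign8 (n - h)"
    by (simp add: sign8_def diff_add_eq)
qed

lemma sign8_add_8_mult: "sign8 (n + 8 * k) = sign8 n"
  by (simp add: sign8_def)

lemma int_card_Collect:
  fixes K :: "'a::finite set"
  shows "int (card {x \<in> K. P x}) = (\<Sum>x\<in>K. of_bool (P x))"
  by (simp add: of_bool_def sum.If_cases Int_def)

locale intersection_setting = octic_character K q \<omega> chi8
  for K :: "'a::{field,finite} set" and q :: nat and \<omega> :: 'a and chi8 :: "'a \<Rightarrow> complex" +
  fixes m \<epsilon> \<delta> h' l :: int
  assumes q_m: "int q = 4 * m\<^sup>2 + 4 * m + 3"
    and eps: "\<epsilon> \<in> {1, - 1}" and del: "\<delta> \<in> {1, - 1}"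
    and gauss: "gauss_sum UNIV chi8 =
      gauss_sum K (quad_char K) * (of_int (\<epsilon> * (2 * m + 1)) + of_int \<delta> * csqrt (- 2))"
    and l_not_dvd: "\<not> int q + 1 dvd l"
    and chi8_l: "chi8 (\<omega> powi l) = zeta8 powi (2 - 5 * \<epsilon> * \<delta> - 6 * h')"
    and chi8_diff: "chi8 (\<omega> powi (l * int q) - \<omega> powi l) = - (\<i> powi \<delta>)"
begin

definition A :: 'a where "A = \<omega> powi l"

definition e :: int where "e = 2 - 5 * \<epsilon> * \<delta> - 6 * h'"

text \<open>Some discrete logarithm of \<open>1 + x * A\<close>; only its classes modulo divisors of
  \<open>q^2 - 1\<close> matter.\<close>

definition ind :: "'a \<Rightarrow> int" where "ind x = (SOME n. \<omega> powi n = 1 + x * A)"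

definition quad_int :: "'a \<Rightarrow> int" where
  "quad_int x = (if x = 0 then 0 else if x \<in> nonzero_squares K then 1 else - 1)"

lemma quad_char_eq_of_int: "quad_char K x = of_int (quad_int x)"
  by (simp add: quad_char_def quad_int_def)

lemma A_notin_K: "A \<notin> K"
  using l_not_dvd by (simp add: A_def omega_powi_in_K_iff)

lemma omega_powi_ind:
  assumes "x \<in> K"
  shows "\<omega> powi ind x = 1 + x * A"
proof -
  obtain n where "1 + x * A = \<omega> powi n"
    using line_nonzero[OF A_notin_K assms] by (rule nonzero_omega_powi)
  then have "\<omega> powi n = 1 + x * A" ..
  then show ?thesis unfolding ind_def by (rule someI)
qed

lemma chi8_ind: "x \<in> K \<Longrightarrow> chi8 (1 + x * A) = zeta8 powi ind x"
  using chi8_omega_powi[of "ind x"] by (simp add: omega_powi_ind)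

lemma chi8_A: "chi8 A = zeta8 powi e" and chi8_A_diff: "chi8 (A ^ q - A) = - (zeta8 powi (2 * \<delta>))"
proof -
  show "chi8 A = zeta8 powi e" using chi8_l by (simp add: A_def e_def)
  have "\<omega> powi (l * int q) = A ^ q" by (simp add: A_def power_int_mult)
  moreover have "\<i> powi \<delta> = zeta8 powi (2 * \<delta>)"
    by (simp add: power_int_mult zeta8_power_2)
  ultimately show "chi8 (A ^ q - A) = - (zeta8 powi (2 * \<delta>))"
    using chi8_diff unfolding A_def[symmetric] by metis
qed

text \<open>The exponent \<open>e\<close> is odd because \<open>\<epsilon> * \<delta>\<close>
  is.\<close>

lemma zeta8_powi_e_power_4: "(zeta8 powi e) ^ 4 = - 1"
proof -
  have "(zeta8 powi e) ^ 4 = zeta8 powi (4 * e)"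
    unfolding mult.commute[of 4 e] by (simp add: power_int_mult)
  also have "\<dots> = (- 1) powi e" by (simp add: power_int_mult zeta8_power_4)
  finally show ?thesis using eps del by (auto simp: power_int_minus_left e_def)
qed

lemma eisenstein_value:
  "zeta8 powi n * eisenstein_sum chi8 1 = of_int (\<epsilon> * (2 * m + 1)) * zeta8 powi n
    + of_int \<delta> * zeta8 powi (n + 1) + of_int \<delta> * zeta8 powi (n + 3)"
proof -
  have "eisenstein_sum chi8 1 = of_int (\<epsilon> * (2 * m + 1)) + of_int \<delta> * (zeta8 + zeta8 ^ 3)"
    using eisenstein_sum_chi8[OF gauss] by (simp add: csqrt_minus_2)
  then show ?thesis by (simp add: power_int_add algebra_simps)
qed

text \<open>The minus signs of \<open>chi8 (A ^ q - A)\<close> and \<open>chi8 A ^ 4\<close> cancel,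
  leaving \<open>zeta8 powi (2 * \<delta> + e)\<close> times the Eisenstein sum; the relation is
  then transported to \<open>\<phi>\<close>.\<close>

lemma sum_ind:
  assumes "antiperiodic4 \<phi>"
  shows "(\<Sum>x\<in>K. \<phi> (ind x)) =
    \<epsilon> * (2 * m + 1) * \<phi> (2 * \<delta> + e) + \<delta> * \<phi> (2 * \<delta> + e + 1) + \<delta> * \<phi> (2 * \<delta> + e + 3)"
proof -
  have "(\<Sum>x\<in>K. zeta8 powi ind x) = (\<Sum>x\<in>K. chi8 (1 + x * A))"
    by (simp add: chi8_ind)
  also have "\<dots> = zeta8 powi (2 * \<delta> + e) * eisenstein_sum chi8 1"
    unfolding chi8_sum_line[OF A_notin_K] chi8_A chi8_A_diff zeta8_powi_e_power_4
    by (simp add: power_int_add)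
  finally show ?thesis
    using zeta8_relation_antiperiodic[OF assms, where X = K and g = "\<lambda>_. 1" and i = ind
        and ?a1.0 = "\<epsilon> * (2 * m + 1)" and ?n1.0 = "2 * \<delta> + e"
        and ?a2.0 = \<delta> and ?n2.0 = "2 * \<delta> + e + 1"
        and ?a3.0 = \<delta> and ?n3.0 = "2 * \<delta> + e + 3" and ?a4.0 = 0]
    unfolding eisenstein_value by simp
qed

lemma sum_ind_twisted:
  assumes "antiperiodic4 \<phi>" and s: "s \<in> K"
  shows "(\<Sum>x\<in>K. quad_int (x - s) * \<phi> (ind x)) =
    \<epsilon> * (2 * m + 1) * \<phi> (2 * \<delta> + 5 * ind s) + \<delta> * \<phi> (2 * \<delta> + 5 * ind s + 1)
    + \<delta> * \<phi> (2 * \<delta> + 5 * ind s + 3) - \<phi> e"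
proof -
  have "(zeta8 powi ind s) ^ 5 = zeta8 powi (5 * ind s)"
    unfolding mult.commute[of 5] by (simp add: power_int_mult)
  then have pow: "chi8 (1 + s * A) ^ 5 = zeta8 powi (5 * ind s)"
    using chi8_ind[OF s] by simp
  have "(\<Sum>x\<in>K. of_int (quad_int (x - s)) * zeta8 powi ind x) =
      (\<Sum>x\<in>K. quad_char K (x - s) * chi8 (1 + x * A))"
    by (simp add: chi8_ind quad_char_eq_of_int)
  also have "\<dots> = zeta8 powi (2 * \<delta> + 5 * ind s) * eisenstein_sum chi8 1 - zeta8 powi e"
    unfolding chi8_sum_line_twisted[OF A_notin_K s] chi8_A chi8_A_diff pow
    by (simp add: power_int_add)
  finally show ?thesis
    using zeta8_relation_antiperiodic[OF assms(1), where X = K and g = "\<lambda>x. quad_int (x - s)" and i = ind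
        and ?a1.0 = "\<epsilon> * (2 * m + 1)" and ?n1.0 = "2 * \<delta> + 5 * ind s"
        and ?a2.0 = \<delta> and ?n2.0 = "2 * \<delta> + 5 * ind s + 1"
        and ?a3.0 = \<delta> and ?n3.0 = "2 * \<delta> + 5 * ind s + 3" and ?a4.0 = "- 1" and ?n4.0 = e]
    unfolding eisenstein_value by simp
qed

text \<open>Here \<open>(q + 1) / 4 = m^2 + m + 1\<close>, and the value of \<open>chi8 A\<close>
  forces \<open>l\<close> to be congruent to \<open>e\<close> modulo 8.\<close>

lemma card_ind_mod_4:
  "int (card {x \<in> K. [ind x = k] (mod 4)}) = m\<^sup>2 + m + 1 - of_bool ([e = k] (mod 4))"
proof -
  define n where "n = nat (m\<^sup>2 + m + 1)"
  have "4 * (m\<^sup>2 + m + 1) = int q + 1" using q_m by simp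
  then have n: "q + 1 = 4 * n" "int n = m\<^sup>2 + m + 1" by (simp_all add: n_def)
  have "zeta8 powi l = zeta8 powi e" using chi8_omega_powi chi8_A by (simp add: A_def)
  then have "[l = e] (mod 8)" by (rule zeta8_powi_eq_imp_cong)
  then have "[l = e] (mod 4)" by (rule cong_dvd_modulus) simp
  then have "[l = k] (mod 4) \<longleftrightarrow> [e = k] (mod 4)" by (simp add: cong_def)
  then show ?thesis
    using card_line_index_mod_4[of l ind n k] A_notin_K omega_powi_ind n by (simp add: A_def)
qed

lemma card_ind_mod_8:
  "2 * int (card {x \<in> K. [ind x = k] (mod 8)}) = m\<^sup>2 + m + 1 - of_bool ([e = k] (mod 4))
    + \<epsilon> * (2 * m + 1) * coord8 k (2 * \<delta> + e) + \<delta> * coord8 k (2 * \<delta> + e + 1)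
    + \<delta> * coord8 k (2 * \<delta> + e + 3)"
proof -
  \<comment> \<open>A class modulo 4 splits into two modulo 8, whose sum is known by
    equidistribution and whose difference, \<open>coord8 k\<close>, by
    \<open>sum_ind\<close>.\<close>
  have pointwise: "2 * of_bool ([n = k] (mod 8)) = of_bool ([n = k] (mod 4)) + coord8 k n" for n
  proof -
    have "4 dvd d \<longleftrightarrow> 8 dvd d \<or> 8 dvd d - 4" "\<not> (8 dvd d \<and> 8 dvd d - 4)" for d :: int
      by presburger+
    from this[of "n - k"] show ?thesis by (auto simp: coord8_def cong_iff_dvd_diff diff_diff_eq)
  qed
  have "2 * int (card {x \<in> K. [ind x = k] (mod 8)}) =
      (\<Sum>x\<in>K. of_bool ([ind x = k] (mod 4))) + (\<Sum>x\<in>K. coord8 k (ind x))"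
    unfolding int_card_Collect sum_distrib_left pointwise by (simp only: sum.distrib)
  also have "(\<Sum>x\<in>K. of_bool ([ind x = k] (mod 4))) = m\<^sup>2 + m + 1 - of_bool ([e = k] (mod 4))"
    unfolding int_card_Collect[symmetric] card_ind_mod_4 ..
  finally show ?thesis unfolding sum_ind[OF antiperiodic4_coord8] by simp
qed

section \<open>The set \<open>D\<close> and its size\<close>

definition off :: int where "off = (1 - \<epsilon> * \<delta>) div 2"

definition h :: int where "h = 2 * h' + off"

definition D :: "'a set" where "D = {x \<in> K. (ind x - h) mod 8 < 4}"

lemma D_set_eq: "D_set K \<omega> l {(h + i) mod 8 | i. i \<in> {0, 1, 2, 3}} = D"
proof -
  obtain j where j: "int q = 8 * j + 3" by (rule q_eq)
  have dvd: "8 dvd (int q)\<^sup>2 - 1"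
  proof
    show "(int q)\<^sup>2 - 1 = 8 * (8 * j * j + 6 * j + 1)"
      by (simp add: j power2_eq_square algebra_simps)
  qed
  have cyc: "\<omega> powi n \<in> cyc_class 8 \<omega> i \<longleftrightarrow> [n = i] (mod 8)" for n i
  proof -
    have pow: "\<omega> powi i * (\<omega> ^ 8) powi k = \<omega> powi (i + 8 * k)" for k
      using omega_nonzero by (simp add: power_int_add power_int_mult)
    have "\<omega> powi n \<in> cyc_class 8 \<omega> i \<longleftrightarrow> (\<exists>k. [n = i + 8 * k] (mod (int q)\<^sup>2 - 1))"
      by (simp add: cyc_class_def pow omega_powi_eq_iff)
    also have "\<dots> \<longleftrightarrow> [n = i] (mod 8)"
    proof
      assume "\<exists>k. [n = i + 8 * k] (mod (int q)\<^sup>2 - 1)"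
      then obtain k where "[n = i + 8 * k] (mod 8)" using dvd cong_dvd_modulus by blast
      then show "[n = i] (mod 8)" by (simp add: cong_def)
    next
      assume "[n = i] (mod 8)"
      then obtain k where "n = i + 8 * k" using cong_iff_lin[of i n 8] cong_sym by blast
      then have "[n = i + 8 * k] (mod (int q)\<^sup>2 - 1)" by simp
      then show "\<exists>k. [n = i + 8 * k] (mod (int q)\<^sup>2 - 1)" by blast
    qed
    finally show ?thesis .
  qed
  have "(\<exists>i\<in>{0, 1, 2, 3}. [n = (h + i) mod 8] (mod 8)) \<longleftrightarrow> (n - h) mod 8 < 4" for n
  proof -
    have "[n = (h + i) mod 8] (mod 8) \<longleftrightarrow> 8 dvd (n - h) - i" for i
      by (simp add: cong_def mod_eq_dvd_iff algebra_simps)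
    then have "(\<exists>i\<in>{0, 1, 2, 3}. [n = (h + i) mod 8] (mod 8)) \<longleftrightarrow>
        8 dvd (n - h) \<or> 8 dvd (n - h) - 1 \<or> 8 dvd (n - h) - 2 \<or> 8 dvd (n - h) - 3"
      by simp
    also have "8 dvd d \<or> 8 dvd d - 1 \<or> 8 dvd d - 2 \<or> 8 dvd d - 3 \<longleftrightarrow> d mod 8 < 4" for d :: int
      by presburger
    finally show ?thesis .
  qed
  then have "1 + x * A \<in> (\<Union>i\<in>{(h + i) mod 8 | i. i \<in> {0, 1, 2, 3}}. cyc_class 8 \<omega> i)
      \<longleftrightarrow> (ind x - h) mod 8 < 4" if "x \<in> K" for x
    unfolding omega_powi_ind[OF that, symmetric] UN_iff cyc by blast
  then show ?thesis by (auto simp: D_set_def D_def A_def)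
qed

lemma sign8_eq_of_bool: "sign8 (ind x - h) = 2 * of_bool ((ind x - h) mod 8 < 4) - 1"
  by (simp add: sign8_def)

lemma card_D_eq_sum: "int (card D) = (\<Sum>x\<in>K. of_bool ((ind x - h) mod 8 < 4))"
  unfolding D_def by (rule int_card_Collect)

text \<open>The sum of \<open>sign8 (ind x - h)\<close> is \<open>2 * card D - q\<close>. Since
  \<open>e - h\<close> depends on \<open>h'\<close> only through \<open>- 8 * h'\<close>, just the
  four sign choices remain.\<close>

lemma card_D: "int (card D) = 2 * m\<^sup>2 + m + 2"
proof -
  have "(\<Sum>x\<in>K. sign8 (ind x - h)) = 2 * int (card D) - int q"
    unfolding sign8_eq_of_bool card_D_eq_sum
    by (simp add: sum_subtractf card_K flip: sum_distrib_left)
  moreover have "sign8 (2 * \<delta> + e + c - h) = sign8 (2 - 5 * (\<epsilon> * \<delta>) + 2 * \<delta> + c - off)" for c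
  proof -
    have "2 * \<delta> + e + c - h = (2 - 5 * (\<epsilon> * \<delta>) + 2 * \<delta> + c - off) + 8 * (- h')"
      by (simp add: e_def h_def)
    then show ?thesis by (simp only: sign8_add_8_mult)
  qed
  note this[of 0] this[of 1] this[of 3]
  ultimately have "2 * int (card D) - int q = \<epsilon> * (2 * m + 1) * sign8 (2 - 5 * (\<epsilon> * \<delta>) + 2 * \<delta> - off)
      + \<delta> * sign8 (2 - 5 * (\<epsilon> * \<delta>) + 2 * \<delta> + 1 - off)
      + \<delta> * sign8 (2 - 5 * (\<epsilon> * \<delta>) + 2 * \<delta> + 3 - off)"
    using sum_ind[OF antiperiodic4_sign8[of h]] by simp
  then show ?thesis
    using eps del q_m by (auto simp: sign8_def off_def)
qed

section \<open>Intersections of \<open>D\<close> with translates of the squares\<close>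

lemma sum_quad_int: "s \<in> K \<Longrightarrow> (\<Sum>x\<in>K. quad_int (x - s)) = 0"
proof -
  assume s: "s \<in> K"
  obtain k where k: "k \<in> K - {0}" "chi8 k \<noteq> 1" by (rule chi8_nontrivial_on_K)
  have "of_int (\<Sum>x\<in>K. quad_int x) = (\<Sum>x\<in>K. quad_char K x)"
    by (simp add: quad_char_eq_of_int)
  also have "\<dots> = (\<Sum>x\<in>K - {0}. chi8 x)"
    using zero_in_K by (subst sum.remove[of _ 0]) (auto simp: chi8_K_eq_quad_char quad_char_def)
  also have "\<dots> = 0"
    using mult_char k by (intro mult_char_sum_eq_0[of _ k]) (auto simp: mult_char_def)
  finally have "(\<Sum>x\<in>K. quad_int x) = 0" by (simp only: of_int_eq_0_iff)
  then show ?thesis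
    using sum.reindex_bij_betw[OF bij_K_translate[OF K_uminus[OF s]], of quad_int] by simp
qed

lemma card_intersection:
  assumes s: "s \<in> K"
  shows "4 * int (card (D \<inter> (\<lambda>x. x + s) ` (nonzero_squares K \<union> {0}))) =
    2 * int (card D) + (\<Sum>x\<in>K. quad_int (x - s) * sign8 (ind x - h))
    + 2 * of_bool ((ind s - h) mod 8 < 4)"
proof -
  define P where "P x \<longleftrightarrow> (ind x - h) mod 8 < 4" for x
  have zero: "0 \<notin> nonzero_squares K" by (auto simp: nonzero_squares_def)
  have mem: "x \<in> (\<lambda>x. x + s) ` (nonzero_squares K \<union> {0}) \<longleftrightarrow> x - s \<in> nonzero_squares K \<union> {0}" for x
    by (force simp: image_iff)
  have "D \<inter> (\<lambda>x. x + s) ` (nonzero_squares K \<union> {0}) =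
      {x \<in> K. P x \<and> x - s \<in> nonzero_squares K \<union> {0}}"
    using mem by (auto simp: D_def P_def)
  then have "4 * int (card (D \<inter> (\<lambda>x. x + s) ` (nonzero_squares K \<union> {0}))) =
      (\<Sum>x\<in>K. 4 * of_bool (P x \<and> x - s \<in> nonzero_squares K \<union> {0}))"
    by (simp only: int_card_Collect sum_distrib_left)
  \<comment> \<open>For \<open>x \<noteq> s\<close> this multiplies out two indicators, each of the
    form (1 + sign) / 2. At \<open>x = s\<close> the quadratic character is 0 while the point
    counts, hence the correction.\<close>
  also have "\<dots> = (\<Sum>x\<in>K. 2 * of_bool (P x) + quad_int (x - s) * sign8 (ind x - h)
      + quad_int (x - s) + (if x = s then 2 * of_bool (P s) else 0))"
    using zero by (intro sum.cong refl) (auto simp: quad_int_def sign8_def P_def)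
  also have "\<dots> = 2 * int (card D) + (\<Sum>x\<in>K. quad_int (x - s) * sign8 (ind x - h))
      + 2 * of_bool (P s)"
    using s by (simp add: sum.distrib sum_quad_int card_D_eq_sum P_def flip: sum_distrib_left)
  finally show ?thesis by (simp add: P_def)
qed

definition isect :: "'a \<Rightarrow> int" where
  "isect s = int (card (D \<inter> (\<lambda>x. x + s) ` (nonzero_squares K \<union> {0})))"

text \<open>Subtracting \<open>2 * h'\<close> eliminates \<open>h'\<close> from the intersection
  numbers, because \<open>5 * (2 * h') - 2 * h' = 8 * h'\<close>.\<close>

definition rel_ind :: "'a \<Rightarrow> int" where "rel_ind s = (ind s - 2 * h') mod 8"

lemma isect_formula:
  assumes s: "s \<in> K"
  defines "t \<equiv> rel_ind s"
  shows "4 * isect s = 4 * m\<^sup>2 + 2 * m + 5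
    + \<epsilon> * (2 * m + 1) * sign8 (2 * \<delta> + 5 * t - off) + \<delta> * sign8 (2 * \<delta> + 5 * t + 1 - off)
    + \<delta> * sign8 (2 * \<delta> + 5 * t + 3 - off) + 2 * of_bool ((t - off) mod 8 < 4)"
proof -
  define c where "c = (ind s - 2 * h') div 8"
  have c: "ind s = 2 * h' + t + 8 * c"
    using mult_div_mod_eq[of 8 "ind s - 2 * h'"] unfolding t_def rel_ind_def c_def by linarith
  have shift: "sign8 (2 * \<delta> + 5 * ind s + b - h) = sign8 (2 * \<delta> + 5 * t + b - off)" for b
  proof -
    have "2 * \<delta> + 5 * ind s + b - h = (2 * \<delta> + 5 * t + b - off) + 8 * (h' + 5 * c)"
      by (simp add: c h_def)
    then show ?thesis by (simp only: sign8_add_8_mult)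
  qed
  \<comment> \<open>This turns the term \<open>- \<phi> e\<close> of the twisted sum into
    \<open>+ 1\<close>, whence the constant 5 rather than 4.\<close>
  have "sign8 (e - h) = - 1"
  proof -
    have "e - h = (2 - 5 * (\<epsilon> * \<delta>) - off) + 8 * (- h')" by (simp add: e_def h_def)
    then have "sign8 (e - h) = sign8 (2 - 5 * (\<epsilon> * \<delta>) - off)" by (simp only: sign8_add_8_mult)
    then show ?thesis using eps del by (auto simp: sign8_def off_def)
  qed
  moreover have "(ind s - h) mod 8 = (t - off) mod 8"
    unfolding c h_def by (simp add: mod_eq_dvd_iff)
  ultimately show ?thesis
    using card_intersection[OF s] sum_ind_twisted[OF antiperiodic4_sign8[of h] s]
      shift[of 0] shift[of 1] shift[of 3]
    by (simp add: isect_def card_D)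
qed

lemma rel_ind_cases:
  "rel_ind s = 0 \<or> rel_ind s = 1 \<or> rel_ind s = 2 \<or> rel_ind s = 3 \<or>
   rel_ind s = 4 \<or> rel_ind s = 5 \<or> rel_ind s = 6 \<or> rel_ind s = 7"
  unfolding rel_ind_def by presburger

lemma eps_del_cases: "\<epsilon> = 1 \<and> \<delta> = 1 \<or> \<epsilon> = 1 \<and> \<delta> = - 1 \<or> \<epsilon> = - 1 \<and> \<delta> = 1 \<or> \<epsilon> = - 1 \<and> \<delta> = - 1"
  using eps del by auto

lemma isect_mem:
  assumes "s \<in> K"
  shows "isect s \<in> {m\<^sup>2 + 1, m\<^sup>2 + 2, m\<^sup>2 + m + 1, m\<^sup>2 + m + 2}"
proof -
  have "4 * isect s \<in> {4 * m\<^sup>2 + 4, 4 * m\<^sup>2 + 8, 4 * m\<^sup>2 + 4 * m + 4, 4 * m\<^sup>2 + 4 * m + 8}"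
    unfolding isect_formula[OF assms] sign8_def off_def
    using eps_del_cases rel_ind_cases[of s] by (elim disjE conjE) simp_all
  then show ?thesis by auto
qed

text \<open>One class per value: the first two contain \<open>(m^2 + m + 2) / 2\<close> points each
  and the last two \<open>(m^2 + m) / 2\<close>, as the counts in \<open>isect_range\<close>
  show.\<close>

lemma isect_eq:
  assumes "s \<in> K"
  shows "rel_ind s = 2 \<Longrightarrow> isect s = m\<^sup>2 + 1"
    and "rel_ind s = 2 - 2 * (\<epsilon> * \<delta>) \<Longrightarrow> isect s = m\<^sup>2 + m + 2"
    and "rel_ind s = 2 - \<epsilon> * \<delta> \<Longrightarrow> isect s = m\<^sup>2 + 2"
    and "rel_ind s = 6 - \<epsilon> * \<delta> \<Longrightarrow> isect s = m\<^sup>2 + m + 1"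
proof -
  note rules = isect_formula[OF assms] sign8_def off_def
  show "isect s = m\<^sup>2 + 1" if "rel_ind s = 2"
  proof -
    have "4 * isect s = 4 * m\<^sup>2 + 4"
      unfolding rules using eps_del_cases that by (elim disjE conjE) simp_all
    then show ?thesis by simp
  qed
  show "isect s = m\<^sup>2 + m + 2" if "rel_ind s = 2 - 2 * (\<epsilon> * \<delta>)"
  proof -
    have "4 * isect s = 4 * m\<^sup>2 + 4 * m + 8"
      unfolding rules using eps_del_cases that by (elim disjE conjE) simp_all
    then show ?thesis by simp
  qed
  show "isect s = m\<^sup>2 + 2" if "rel_ind s = 2 - \<epsilon> * \<delta>"
  proof -
    have "4 * isect s = 4 * m\<^sup>2 + 8"
      unfolding rules using eps_del_cases that by (elim disjE conjE) simp_all
    then show ?thesis by simp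
  qed
  show "isect s = m\<^sup>2 + m + 1" if "rel_ind s = 6 - \<epsilon> * \<delta>"
  proof -
    have "4 * isect s = 4 * m\<^sup>2 + 4 * m + 4"
      unfolding rules using eps_del_cases that by (elim disjE conjE) simp_all
    then show ?thesis by simp
  qed
qed

section \<open>Class sizes and attainment of all four values\<close>

lemma card_rel_ind:
  "2 * int (card {x \<in> K. [ind x = 2 * h' + t] (mod 8)}) =
    m\<^sup>2 + m + 1 - of_bool ([2 - 5 * (\<epsilon> * \<delta>) = t] (mod 4))
    + \<epsilon> * (2 * m + 1) * coord8 t (2 * \<delta> + 2 - 5 * (\<epsilon> * \<delta>))
    + \<delta> * coord8 t (3 + 2 * \<delta> - 5 * (\<epsilon> * \<delta>)) + \<delta> * coord8 t (5 + 2 * \<delta> - 5 * (\<epsilon> * \<delta>))"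
proof -
  \<comment> \<open>The part \<open>- 6 * h'\<close> of \<open>e\<close> and the shift by
    \<open>2 * h'\<close> combine to a multiple of 8, so \<open>h'\<close> disappears.\<close>
  have c: "coord8 (2 * h' + t) (n - 6 * h') = coord8 t n" for n
  proof -
    have "n - 6 * h' - (2 * h' + u) = n - u + 8 * (- h')" for u by simp
    then have "8 dvd n - 6 * h' - (2 * h' + u) \<longleftrightarrow> 8 dvd n - u" for u
      by (simp only: dvd_add_left_iff dvd_triv_left)
    from this[of t] this[of "t + 4"] show ?thesis
      by (simp add: coord8_def cong_iff_dvd_diff add.assoc)
  qed
  have "e - (2 * h' + t) = 2 - 5 * (\<epsilon> * \<delta>) - t + 4 * (- 2 * h')" by (simp add: e_def)
  then have "[e = 2 * h' + t] (mod 4) \<longleftrightarrow> [2 - 5 * (\<epsilon> * \<delta>) = t] (mod 4)"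
    unfolding cong_iff_dvd_diff by (simp only: dvd_add_left_iff dvd_triv_left)
  moreover have "coord8 (2 * h' + t) (2 * \<delta> + e + b) = coord8 t (2 * \<delta> + 2 + b - 5 * (\<epsilon> * \<delta>))" for b
    by (subst c[symmetric], rule arg_cong[where f = "coord8 (2 * h' + t)"]) (simp add: e_def)
  note this[of 0] this[of 1] this[of 3]
  ultimately show ?thesis using card_ind_mod_8[of "2 * h' + t"] by simp
qed

lemma rel_ind_attained:
  assumes "int (card {x \<in> K. [ind x = 2 * h' + t] (mod 8)}) > 0" "0 \<le> t" "t < 8"
  shows "\<exists>s\<in>K. rel_ind s = t"
proof -
  from assms(1) have "{x \<in> K. [ind x = 2 * h' + t] (mod 8)} \<noteq> {}" by force
  then obtain x where x: "x \<in> K" "[ind x = 2 * h' + t] (mod 8)" by blast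
  then have "[ind x - 2 * h' = t] (mod 8)" by (simp add: cong_iff_dvd_diff algebra_simps)
  then have "rel_ind x = t" using assms(2,3) by (simp add: rel_ind_def cong_def)
  with x(1) show ?thesis by blast
qed

lemma isect_range:
  assumes "m \<noteq> - 1"
  shows "isect ` K = {m\<^sup>2 + 1, m\<^sup>2 + 2, m\<^sup>2 + m + 1, m\<^sup>2 + m + 2}"
proof -
  have eq: "m\<^sup>2 + m = m * (m + 1)" by (simp add: power2_eq_square algebra_simps)
  have pos: "m\<^sup>2 + m > 0" if "m \<noteq> 0"
    unfolding eq zero_less_mult_iff using that assms by linarith
  then have nonneg: "m\<^sup>2 + m \<ge> 0" by (cases "m = 0") auto
  have "2 * int (card {x \<in> K. [ind x = 2 * h' + t] (mod 8)}) = m\<^sup>2 + m + 2"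
    if "t = 2 \<or> t = 2 - 2 * (\<epsilon> * \<delta>)" for t
    using card_rel_ind[of t] eps_del_cases that
    by (elim disjE conjE) (simp_all add: coord8_def cong_def)
  then have ex1: "\<exists>s\<in>K. rel_ind s = t" if "t = 2 \<or> t = 2 - 2 * (\<epsilon> * \<delta>)" for t
    using that nonneg eps_del_cases by (intro rel_ind_attained) fastforce+
  have "2 * int (card {x \<in> K. [ind x = 2 * h' + t] (mod 8)}) = m\<^sup>2 + m"
    if "t = 2 - \<epsilon> * \<delta> \<or> t = 6 - \<epsilon> * \<delta>" for t
    using card_rel_ind[of t] eps_del_cases that
    by (elim disjE conjE) (simp_all add: coord8_def cong_def)
  \<comment> \<open>These two classes are empty exactly when \<open>m * (m + 1) = 0\<close>. For
    \<open>m = 0\<close> the values they would supply coincide with those of the first two classes;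
    for \<open>m = - 1\<close> they do not.\<close>
  then have ex2: "\<exists>s\<in>K. rel_ind s = t" if "m \<noteq> 0" "t = 2 - \<epsilon> * \<delta> \<or> t = 6 - \<epsilon> * \<delta>" for t
    using that pos eps_del_cases by (intro rel_ind_attained) fastforce+
  have 1: "m\<^sup>2 + 1 \<in> isect ` K" "m\<^sup>2 + m + 2 \<in> isect ` K"
    using ex1 isect_eq(1,2) by (metis image_eqI)+
  have "m\<^sup>2 + 2 \<in> isect ` K \<and> m\<^sup>2 + m + 1 \<in> isect ` K"
  proof (cases "m = 0")
    case True
    then show ?thesis using 1 by simp
  next
    case False
    then show ?thesis using ex2 isect_eq(3,4) by (metis image_eqI)
  qed
  with 1 isect_mem show ?thesis by blast
qed

end

theorem theorem4p2:
  fixes m :: int and q :: nat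
    and K :: "'a::{field,finite} set" and \<omega> :: 'a
    and chi8 :: "'a \<Rightarrow> complex"
    and \<epsilon> \<delta> h' h l :: int and H :: "int set"
  assumes "int q = 4 * m\<^sup>2 + 4 * m + 3" and "primepow q"
    and "CARD('a) = q\<^sup>2"
    and "is_subfield K" and "card K = q"
    and "primitive_element \<omega>"
    and "mult_char UNIV chi8" and "chi8 \<omega> = exp (2 * of_real pi * \<i> / 8)"
    and "\<epsilon> \<in> {1, - 1}" and "\<delta> \<in> {1, - 1}"
    and "gauss_sum UNIV chi8 =
           gauss_sum K (quad_char K) * (of_int (\<epsilon> * (2 * m + 1)) + of_int \<delta> * csqrt (- 2))"
    and "h' \<in> {0, 1, 2, 3}" and "h = 2 * h' + (1 - \<epsilon> * \<delta>) div 2"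
    and "\<not> (int q + 1) dvd l"
    and "chi8 (\<omega> powi l) = exp (2 * of_real pi * \<i> / 8) powi (2 - 5 * \<epsilon> * \<delta> - 6 * h')"
    and "chi8 (\<omega> powi (l * int q) - \<omega> powi l) = - (\<i> powi \<delta>)"
    and "H = {(h + i) mod 8 | i. i \<in> {0, 1, 2, 3}}"
  shows "int (card (D_set K \<omega> l H)) = 2 * m\<^sup>2 + m + 2 \<and>
    (m \<noteq> - 1 \<longrightarrow>
      {int (card (D_set K \<omega> l H \<inter> (\<lambda>x. x + s) ` (nonzero_squares K \<union> {0}))) | s. s \<in> K}
        = {m\<^sup>2 + 1, m\<^sup>2 + 2, m\<^sup>2 + m + 1, m\<^sup>2 + m + 2})"
proof -
  \<comment> \<open>Since \<open>q = 4 * (m^2 + m) + 3\<close>, this parity gives the residue 3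
    modulo 8.\<close>
  have "even (m\<^sup>2 + m)" by (simp add: power2_eq_square)
  then obtain j where "m\<^sup>2 + m = 2 * j" by (rule evenE)
  then have "int q = 8 * j + 3" using assms(1) by simp
  then have "q mod 8 = 3" by presburger
  then interpret S: intersection_setting K q \<omega> chi8 m \<epsilon> \<delta> h' l
    using assms by unfold_locales (simp_all add: zeta8_def)
  have "h = S.h" using assms(13) by (simp add: S.h_def S.off_def)
  then have D: "D_set K \<omega> l H = S.D" using S.D_set_eq assms(17) by simp
  have "{int (card (S.D \<inter> (\<lambda>x. x + s) ` (nonzero_squares K \<union> {0}))) | s. s \<in> K} = S.isect ` K"
    by (auto simp: S.isect_def)
  then show ?thesis unfolding D using S.card_D S.isect_range by simp
qed

end
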